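(* Let $t_0\ge1$, $\gamma(t)=\frac{\alpha}{t^r}$ with $r\in[0,1)$ and $\alpha>0$, and $\delta(t)=\frac{t}{2r_0}$ with $r_0>r$. Let $\epsilon_1:[t_0,+\infty)\to\mathbb{R}^{n_1}$ and $\epsilon_2:[t_0,+\infty)\to\mathbb{R}^{n_2}$ be locally integrable functions satisfying $$\int_{t_0}^{+\infty}t^{r}\|\epsilon_i(t)\|\,dt<+\infty,\qquad i=1,2.$$ Suppose that $(x^*,y^*,\lambda^* )\in\Omega$ and that $(x(t),y(t),\lambda(t))$ is a global solution of the perturbed dynamical system (P) (given in the context). Then: (a) $\mathcal{L}(x(t),y(t),\lambda^* )-\mathcal{L}(x^*,y^*,\lambda^* )=\mathcal{O}(t^{-2r})$. (b) $\|Ax(t)+By(t)-b\|=\mathcal{O}(t^{-r})$. (c) $\int_{t_0}^{+\infty}t^{2r-1}\|Ax(t)+By(t)-b\|^2\,dt<+\infty$. (d) $\int_{t_0}^{+\infty}t^r\big(\|\dot x(t)\|^2+\|\dot y(t)\|^2+\|\dot\lambda(t)\|^2\big)\,dt<+\infty$. (e) $\int_{t_0}^{+\infty}t^{2r-1}\big(\mathcal{L}(x(t),y(t),\lambda^* )-\mathcal{L}(x^*,y^*,\lambda^* )\big)\,dt<+\infty$. (f) $\|\dot x(t)\|+\|\dot y(t)\|+\|\dot\lambda(t)\|=\mathcal{O}(t^{-r})$.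
   Context: All spaces are Euclidean with inner product $\langle\cdot,\cdot\rangle$ and norm $\|\cdot\|$. $f:\mathbb{R}^{n_1}\to\mathbb{R}$ and $g:\mathbb{R}^{n_2}\to\mathbb{R}$ are smooth (continuously differentiable) convex functions, $A\in\mathbb{R}^{m\times n_1}$, $B\in\mathbb{R}^{m\times n_2}$, $b\in\mathbb{R}^m$. $\Omega$ is the set of $(x^*,y^*,\lambda^* )\in\mathbb{R}^{n_1}\times\mathbb{R}^{n_2}\times\mathbb{R}^m$ with $-A^T\lambda^*=\nabla f(x^* )$, $-B^T\lambda^*=\nabla g(y^* )$, $Ax^*+By^*-b=0$; it is assumed that $\Omega\neq\emptyset$. The augmented Lagrangian is $$\mathcal{L}(x,y,\lambda)=f(x)+g(y)+\langle\lambda,Ax+By-b\rangle+\tfrac12\|Ax+By-b\|^2.$$ The perturbed dynamical system (P) is $$\begin{cases}\ddot{x}(t)+\gamma(t)\dot{x}(t)=-\nabla f(x(t))-A^T(\lambda(t)+\delta(t)\dot\lambda(t))-A^T(Ax(t)+By(t)-b)+\epsilon_1(t),\\ \ddot{y}(t)+\gamma(t)\dot{y}(t)=-\nabla g(y(t))-B^T(\lambda(t)+\delta(t)\dot\lambda(t))-B^T(Ax(t)+By(t)-b)+\epsilon_2(t),\\ \ddot{\lambda}(t)+\gamma(t)\dot{\lambda}(t)=A(x(t)+\delta(t)\dot{x}(t))+B(y(t)+\delta(t)\dot{y}(t))-b.\end{cases}$$ A global solution is a triple of $C^1$ functions on $[t_0,+\infty)$ with locally absolutely continuous first derivatives satisfying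 (P) for almost every $t\ge t_0$. All $\mathcal{O}(\cdot)$ statements are as $t\to+\infty$. *)

theory Defs
  imports "HOL-Analysis.Analysis" "HOL-Library.Landau_Symbols"
begin

definition grad :: "('a::real_inner \<Rightarrow> real) \<Rightarrow> 'a \<Rightarrow> 'a" where
  "grad f x = (THE D. GDERIV f x :> D)"

definition cont_differentiable :: "('a::real_inner \<Rightarrow> real) \<Rightarrow> bool" where
  "cont_differentiable f \<longleftrightarrow> (\<forall>x. f differentiable (at x)) \<and> continuous_on UNIV (grad f)"

text \<open>Derivative of a function on the half-line \<open>[t\<^sub>0, \<infinity>)\<close>; it is one-sided at \<open>t\<^sub>0\<close>, so values to the
  left of \<open>t\<^sub>0\<close> are irrelevant. It is only meaningful where the function is differentiable.\<close>

definition tderiv :: "real \<Rightarrow> (real \<Rightarrow> 'a::real_normed_vector) \<Rightarrow> real \<Rightarrow> 'a" where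
  "tderiv t0 u t = vector_derivative u (at t within {t0..})"

definition C1_halfline :: "real \<Rightarrow> (real \<Rightarrow> 'a::real_normed_vector) \<Rightarrow> bool" where
  "C1_halfline t0 u \<longleftrightarrow>
     (\<forall>t\<ge>t0. u differentiable (at t within {t0..})) \<and> continuous_on {t0..} (tderiv t0 u)"

text \<open>The usual \<open>\<epsilon>\<close>-\<open>\<delta>\<close> definition of absolute continuity on \<open>[a, b]\<close>; a finite family of
  non-overlapping subintervals \<open>[u, v]\<close> is encoded as a finite set of pairs \<open>(u, v)\<close>.\<close>

definition absolutely_cont_on :: "real \<Rightarrow> real \<Rightarrow> (real \<Rightarrow> 'a::real_normed_vector) \<Rightarrow> bool" where
  "absolutely_cont_on a b h \<longleftrightarrow>
     (\<forall>e>0. \<exists>d>0. \<forall>I. finite I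
        \<and> (\<forall>(u, v)\<in>I. a \<le> u \<and> u \<le> v \<and> v \<le> b)
        \<and> disjoint_family_on (\<lambda>(u, v). {u<..<v}) I
        \<and> (\<Sum>(u, v)\<in>I. v - u) < d
        \<longrightarrow> (\<Sum>(u, v)\<in>I. norm (h v - h u)) < e)"

definition locally_absolutely_cont :: "real \<Rightarrow> (real \<Rightarrow> 'a::real_normed_vector) \<Rightarrow> bool" where
  "locally_absolutely_cont t0 h \<longleftrightarrow> (\<forall>a b. t0 \<le> a \<and> a \<le> b \<longrightarrow> absolutely_cont_on a b h)"

definition locally_integrable :: "real \<Rightarrow> (real \<Rightarrow> 'a::euclidean_space) \<Rightarrow> bool" where
  "locally_integrable t0 h \<longleftrightarrow> (\<forall>a b. t0 \<le> a \<and> a \<le> b \<longrightarrow> h absolutely_integrable_on {a..b})"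

definition Omega ::
  "(real^'n1 \<Rightarrow> real) \<Rightarrow> (real^'n2 \<Rightarrow> real) \<Rightarrow> real^'n1^'m \<Rightarrow> real^'n2^'m \<Rightarrow> real^'m
   \<Rightarrow> ((real^'n1) \<times> (real^'n2) \<times> (real^'m)) set" where
  "Omega f g A B b = {(x, y, l).
     - (transpose A *v l) = grad f x \<and>
     - (transpose B *v l) = grad g y \<and>
     A *v x + B *v y - b = 0}"

definition aug_Lagrangian ::
  "(real^'n1 \<Rightarrow> real) \<Rightarrow> (real^'n2 \<Rightarrow> real) \<Rightarrow> real^'n1^'m \<Rightarrow> real^'n2^'m \<Rightarrow> real^'m
   \<Rightarrow> real^'n1 \<Rightarrow> real^'n2 \<Rightarrow> real^'m \<Rightarrow> real" where
  "aug_Lagrangian f g A B b x y l =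
     f x + g y + l \<bullet> (A *v x + B *v y - b) + 1/2 * (norm (A *v x + B *v y - b))\<^sup>2"

text \<open>The differentiability conditions express that the second derivatives occurring in the
  system exist at the given time; this holds for almost every time by absolute continuity.\<close>

definition global_solution ::
  "(real^'n1 \<Rightarrow> real) \<Rightarrow> (real^'n2 \<Rightarrow> real) \<Rightarrow> real^'n1^'m \<Rightarrow> real^'n2^'m \<Rightarrow> real^'m
   \<Rightarrow> (real \<Rightarrow> real) \<Rightarrow> (real \<Rightarrow> real) \<Rightarrow> (real \<Rightarrow> real^'n1) \<Rightarrow> (real \<Rightarrow> real^'n2) \<Rightarrow> real
   \<Rightarrow> (real \<Rightarrow> real^'n1) \<Rightarrow> (real \<Rightarrow> real^'n2) \<Rightarrow> (real \<Rightarrow> real^'m) \<Rightarrow> bool" where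
  "global_solution f g A B b \<gamma> \<delta> \<epsilon>1 \<epsilon>2 t0 x y l \<longleftrightarrow>
     C1_halfline t0 x \<and> C1_halfline t0 y \<and> C1_halfline t0 l \<and>
     locally_absolutely_cont t0 (tderiv t0 x) \<and>
     locally_absolutely_cont t0 (tderiv t0 y) \<and>
     locally_absolutely_cont t0 (tderiv t0 l) \<and>
     (AE t\<in>{t0..} in lebesgue.
        tderiv t0 x differentiable (at t within {t0..}) \<and>
        tderiv t0 y differentiable (at t within {t0..}) \<and>
        tderiv t0 l differentiable (at t within {t0..}) \<and>
        tderiv t0 (tderiv t0 x) t + \<gamma> t *\<^sub>R tderiv t0 x t =
          - grad f (x t) - transpose A *v (l t + \<delta> t *\<^sub>R tderiv t0 l t)
          - transpose A *v (A *v x t + B *v y t - b) + \<epsilon>1 t \<and>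
        tderiv t0 (tderiv t0 y) t + \<gamma> t *\<^sub>R tderiv t0 y t =
          - grad g (y t) - transpose B *v (l t + \<delta> t *\<^sub>R tderiv t0 l t)
          - transpose B *v (A *v x t + B *v y t - b) + \<epsilon>2 t \<and>
        tderiv t0 (tderiv t0 l) t + \<gamma> t *\<^sub>R tderiv t0 l t =
          A *v (x t + \<delta> t *\<^sub>R tderiv t0 x t) + B *v (y t + \<delta> t *\<^sub>R tderiv t0 y t) - b)"

end

theory Submission
  imports Defs
begin

text \<open>The proof is a Lyapunov argument. Let \<open>z\<close> be the deviation of \<open>(x, y, \<lambda>)\<close> from the saddle point and
  \<open>w\<close> its derivative. Fixing the multiplier of the augmented Lagrangian at \<open>ls\<close>, the system takes the form

  \<open>w' + \<alpha> t\<^sup>-\<^sup>r w = - DG z + K (z + \<delta> w) + \<epsilon>\<close>,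

  where \<open>G\<close> is the Lagrangian gap, a convex function with minimal value \<open>0\<close> at the origin, and \<open>K\<close> is
  skew-symmetric. With \<open>\<rho> = 2 r\<^sub>0 t\<^sup>r\<^sup>-\<^sup>1\<close> the vector \<open>v = \<rho> z + t\<^sup>r w\<close> is a multiple of \<open>z + \<delta> w\<close>, so
  \<open>K\<close> disappears from the derivative of the energy

  \<open>2 t\<^sup>2\<^sup>r G z + \<xi> (z \<bullet> z) + v \<bullet> v\<close>,

  where \<open>\<xi>\<close> is chosen to cancel the terms \<open>z \<bullet> w\<close>. Convexity and \<open>r < r\<^sub>0\<close>, \<open>r < 1\<close> then show that for large
  \<open>t\<close> this derivative is at most \<open>-2 D + 2 t\<^sup>r |\<epsilon>| |v|\<close>, where the dissipation \<open>D\<close> is a positive combination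
  of \<open>t\<^sup>2\<^sup>r\<^sup>-\<^sup>1 G\<close>, \<open>t\<^sup>2\<^sup>r\<^sup>-\<^sup>1\<close> times the squared residual and \<open>t\<^sup>r |w|\<^sup>2\<close> (lemma \<open>energy_rate\<close>). As
  \<open>t\<^sup>r |\<epsilon>|\<close> is integrable and the energy dominates \<open>|v|\<^sup>2\<close>, both the energy and the integral of \<open>D\<close> stay
  bounded (lemma \<open>bounded_energy\<close>). The integral of \<open>D\<close> gives the three integrability statements. The
  energy bound gives the decay of \<open>G\<close>, hence of the residual because \<open>G\<close> dominates half its square, and
  the decay of the velocity because \<open>\<rho> z\<close> is bounded as well.

  The velocity is only absolutely continuous and the equation holds almost everywhere, so integrating
  the inequality requires the fundamental theorem of calculus for absolutely continuous functions
  (lemma \<open>absolutely_cont_on_fundamental_theorem\<close>).\<close>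

section \<open>Absolutely continuous functions\<close>

text \<open>An absolutely continuous function is recovered from its derivative even when the derivative is
  missing on a null set \<open>N\<close>. In Henstock's definition of the integral this can be seen directly. At a
  tag outside \<open>N\<close> the gauge of differentiability controls the error, as in the classical theorem. The
  intervals tagged in \<open>N\<close> have small total length as soon as the tagged division is fine for a gauge
  witnessing that the indicator of \<open>N\<close> has integral zero, and then absolute continuity makes the total
  increment over them small.\<close>
lemma absolutely_cont_on_fundamental_theorem:
  fixes f :: "real \<Rightarrow> 'a::banach"
  assumes ab: "a \<le> b"
    and ac: "absolutely_cont_on a b f"
    and N: "negligible N"
    and deriv: "\<And>t. t \<in> {a..b} - N \<Longrightarrow> (f has_vector_derivative f' t) (at t within {a..b})"
  shows "(f' has_integral (f b - f a)) {a..b}"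
proof -
  define f0 where "f0 t = (if t \<in> N then 0 else f' t)" for t
  have "(f0 has_integral (f b - f a)) {a..b}"
    unfolding has_integral_real
  proof (intro allI impI)
    fix e :: real assume e: "e > 0"
    define \<eta> where "\<eta> = e / (2 * (b - a) + 2)"
    have \<eta>: "\<eta> > 0" "\<eta> * (b - a) < e / 2"
      using e ab unfolding \<eta>_def by (auto simp: field_simps)
    have "\<exists>\<rho>>0. t \<in> {a..b} - N \<longrightarrow>
         (\<forall>s\<in>{a..b}. norm (s - t) < \<rho> \<longrightarrow> norm (f s - f t - (s - t) *\<^sub>R f' t) \<le> \<eta> * norm (s - t))" for t
    proof (cases "t \<in> {a..b} - N")
      case True
      then show ?thesis
        using deriv[OF True] \<eta>(1) unfolding has_vector_derivative_def has_derivative_within_alt by blast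
    next
      case False
      then show ?thesis by (intro exI[of _ 1]) auto
    qed
    then obtain \<rho> where \<rho>: "\<And>t. 0 < \<rho> t"
      "\<And>t s. \<lbrakk>t \<in> {a..b} - N; s \<in> {a..b}; norm (s - t) < \<rho> t\<rbrakk>
          \<Longrightarrow> norm (f s - f t - (s - t) *\<^sub>R f' t) \<le> \<eta> * norm (s - t)"
      by metis
    have "e / 2 > 0" using e by simp
    then obtain d where d: "d > 0" and dac: "\<And>I. finite I \<Longrightarrow> (\<forall>(u, v)\<in>I. a \<le> u \<and> u \<le> v \<and> v \<le> b)
        \<Longrightarrow> disjoint_family_on (\<lambda>(u, v). {u<..<v}) I \<Longrightarrow> (\<Sum>(u, v)\<in>I. v - u) < d
        \<Longrightarrow> (\<Sum>(u, v)\<in>I. norm (f v - f u)) < e / 2"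
      using ac unfolding absolutely_cont_on_def by meson
    \<comment> \<open>The Riemann sum of the indicator of \<open>N\<close> is the total length of the intervals tagged in \<open>N\<close>.\<close>
    have "((indicator N :: real \<Rightarrow> real) has_integral 0) {a..b}"
      using N unfolding negligible_def box_real[symmetric] by blast
    then obtain \<gamma>1 where \<gamma>1: "gauge \<gamma>1" and small: "\<And>p. p tagged_division_of {a..b} \<Longrightarrow> \<gamma>1 fine p
        \<Longrightarrow> norm ((\<Sum>(x, K)\<in>p. measure lborel K *\<^sub>R (indicator N x :: real)) - 0) < d"
      unfolding has_integral_real using d by metis
    show "\<exists>\<gamma>. gauge \<gamma> \<and> (\<forall>\<D>. \<D> tagged_division_of {a..b} \<and> \<gamma> fine \<D> \<longrightarrow>
          norm ((\<Sum>(x, K)\<in>\<D>. measure lborel K *\<^sub>R f0 x) - (f b - f a)) < e)"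
    proof (intro exI conjI allI impI)
      show "gauge (\<lambda>t. \<gamma>1 t \<inter> ball t (\<rho> t))"
        using \<rho>(1) \<gamma>1 by (intro gauge_Int) (auto simp: gauge_ball_dependent)
      fix p assume "p tagged_division_of {a..b} \<and> (\<lambda>t. \<gamma>1 t \<inter> ball t (\<rho> t)) fine p"
      then have p: "p tagged_division_of {a..b}" and fine1: "\<gamma>1 fine p" and fine2: "(\<lambda>t. ball t (\<rho> t)) fine p"
        by (auto simp: fine_def)
      note pD = tagged_division_ofD[OF p]
      have K: "K = {Inf K..Sup K} \<and> Inf K \<le> t \<and> t \<le> Sup K \<and> a \<le> Inf K \<and> Sup K \<le> b \<and> measure lborel K = Sup K - Inf K"
        if q: "(t, K) \<in> p" for t K
      proof -
        obtain u v where K: "K = {u..v}" using pD(4)[OF q] by auto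
        moreover have "t \<in> K" "K \<subseteq> {a..b}" using pD(2,3)[OF q] by auto
        ultimately show ?thesis by auto
      qed
      define P where "P = {q \<in> p. fst q \<in> N}"
      have fin: "finite p" "finite P" using pD(1) by (auto simp: P_def)
      define ends where "ends = (\<lambda>(t :: real, K :: real set). (Inf K, Sup K))"
      have disj: "{Inf K<..<Sup K} \<inter> {Inf K'<..<Sup K'} = {}"
        if "(t, K) \<in> p" "(t', K') \<in> p" "(t, K) \<noteq> (t', K')" for t t' K K'
      proof -
        have "interior K = {Inf K<..<Sup K}" "interior K' = {Inf K'<..<Sup K'}"
          using K[OF that(1)] K[OF that(2)] by (metis interior_atLeastAtMost_real)+
        then show ?thesis using pD(5)[OF that] by auto
      qed
      \<comment> \<open>Absolute continuity speaks of sets of pairs of endpoints, so no two tagged intervals may share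
        both endpoints. Two tags for one interval force it to have empty interior, hence to be a single
        point, which is then the only possible tag.\<close>
      have inj: "inj_on ends p"
      proof (rule inj_onI, clarsimp simp: ends_def)
        fix t K t' K' assume q: "(t, K) \<in> p" "(t', K') \<in> p" "Inf K = Inf K'" "Sup K = Sup K'"
        then have KK: "K = K'" using K by metis
        show "t = t' \<and> K = K'"
        proof (rule ccontr)
          assume "\<not> (t = t' \<and> K = K')"
          then have "{Inf K<..<Sup K} = {}" using disj[OF q(1,2)] q(3,4) by auto
          then have "Inf K = Sup K" using K[OF q(1)] by (simp add: greaterThanLessThan_empty_iff)
          then show False using K[OF q(1)] K[OF q(2)] q(3,4) KK \<open>\<not> _\<close> by auto
        qed
      qed
      then have injP: "inj_on ends P" by (rule inj_on_subset) (auto simp: P_def)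
      have small_var: "(\<Sum>(t, K)\<in>P. norm (f (Sup K) - f (Inf K))) < e / 2"
      proof -
        have "(\<Sum>(u, v)\<in>ends ` P. norm (f v - f u)) < e / 2"
        proof (rule dac)
          show "finite (ends ` P)" using fin by simp
          show "\<forall>(u, v)\<in>ends ` P. a \<le> u \<and> u \<le> v \<and> v \<le> b"
            using K by (fastforce simp: ends_def P_def)
          show "disjoint_family_on (\<lambda>(u, v). {u<..<v}) (ends ` P)"
            unfolding disjoint_family_on_def
          proof (intro ballI impI)
            fix i j assume "i \<in> ends ` P" "j \<in> ends ` P" and ij: "i \<noteq> j"
            then obtain t K t' K' where q: "(t, K) \<in> p" "(t', K') \<in> p"
              "i = (Inf K, Sup K)" "j = (Inf K', Sup K')" by (auto simp: ends_def P_def)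
            then have "{Inf K<..<Sup K} \<inter> {Inf K'<..<Sup K'} = {}"
              using ij by (intro disj) auto
            then show "(case i of (u, v) \<Rightarrow> {u<..<v}) \<inter> (case j of (u, v) \<Rightarrow> {u<..<v}) = {}"
              using q by simp
          qed
          have "(\<Sum>(u, v)\<in>ends ` P. v - u) = (\<Sum>(t, K)\<in>P. Sup K - Inf K)"
            by (subst sum.reindex[OF injP]) (simp add: ends_def case_prod_unfold)
          also have "\<dots> = (\<Sum>(t, K)\<in>P. measure lborel K *\<^sub>R (indicator N t :: real))"
            using K by (intro sum.cong) (auto simp: P_def)
          also have "\<dots> = (\<Sum>(t, K)\<in>p. measure lborel K *\<^sub>R (indicator N t :: real))"
            using fin by (intro sum.mono_neutral_left) (auto simp: P_def indicator_def split: if_splits)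
          also have "\<dots> < d" using small[OF p fine1] by simp
          finally show "(\<Sum>(u, v)\<in>ends ` P. v - u) < d" .
        qed
        then show ?thesis
          by (subst (asm) sum.reindex[OF injP]) (simp add: ends_def case_prod_unfold)
      qed
      have total: "b - a = (\<Sum>(t, K)\<in>p. Sup K - Inf K)" "f b - f a = (\<Sum>(t, K)\<in>p. f (Sup K) - f (Inf K))"
        using additive_tagged_division_1[OF ab p, of "\<lambda>x. x"] additive_tagged_division_1[OF ab p, of f] by auto
      define err where "err = (\<lambda>(t, K). if t \<in> N then norm (f (Sup K) - f (Inf K)) else \<eta> * (Sup K - Inf K))"
      have "norm ((\<Sum>(t, K)\<in>p. measure lborel K *\<^sub>R f0 t) - (f b - f a))
          = norm (\<Sum>(t, K)\<in>p. measure lborel K *\<^sub>R f0 t - (f (Sup K) - f (Inf K)))"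
        by (simp add: total(2) case_prod_unfold sum_subtractf)
      also have "\<dots> \<le> (\<Sum>q\<in>p. err q)"
      proof (rule sum_norm_le, clarify)
        fix t K assume q: "(t, K) \<in> p"
        show "norm (measure lborel K *\<^sub>R f0 t - (f (Sup K) - f (Inf K))) \<le> err (t, K)"
        proof (cases "t \<in> N")
          case True
          then show ?thesis by (simp add: err_def f0_def norm_minus_commute)
        next
          case False
          define u v where "u = Inf K" and "v = Sup K"
          have Kuv: "K = {u..v}" "u \<le> t" "t \<le> v" "a \<le> u" "v \<le> b" "measure lborel K = v - u"
            using K[OF q] by (auto simp: u_def v_def)
          have t: "t \<in> {a..b} - N" using Kuv False by auto
          have "K \<subseteq> ball t (\<rho> t)" using fine2 q by (auto simp: fine_def)
          moreover have "u \<in> K" "v \<in> K" using Kuv by auto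
          ultimately have "u \<in> ball t (\<rho> t)" "v \<in> ball t (\<rho> t)" by blast+
          then have "norm (u - t) < \<rho> t" "norm (v - t) < \<rho> t" by (auto simp: dist_norm norm_minus_commute)
          then have nu: "norm (f u - f t - (u - t) *\<^sub>R f' t) \<le> \<eta> * norm (u - t)"
            and nv: "norm (f v - f t - (v - t) *\<^sub>R f' t) \<le> \<eta> * norm (v - t)"
            using Kuv by (auto intro!: \<rho>(2)[OF t] simp del: real_norm_def)
          have "norm ((v - u) *\<^sub>R f' t - (f v - f u))
              = norm ((f u - f t - (u - t) *\<^sub>R f' t) - (f v - f t - (v - t) *\<^sub>R f' t))"
            by (simp add: algebra_simps)
          also have "\<dots> \<le> \<eta> * norm (u - t) + \<eta> * norm (v - t)"
            using nu nv norm_triangle_ineq4 order_trans add_mono by meson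
          also have "\<dots> = \<eta> * (v - u)" using Kuv by (simp add: algebra_simps)
          finally show ?thesis using False Kuv(6) by (simp add: err_def f0_def u_def v_def)
        qed
      qed
      also have "\<dots> = (\<Sum>q\<in>P. err q) + (\<Sum>q\<in>p - P. err q)"
        using fin by (subst sum.subset_diff[of P p]) (auto simp: P_def)
      also have "(\<Sum>q\<in>P. err q) = (\<Sum>(t, K)\<in>P. norm (f (Sup K) - f (Inf K)))"
        by (intro sum.cong) (auto simp: P_def err_def)
      also have "(\<Sum>q\<in>p - P. err q) = (\<Sum>(t, K)\<in>p - P. \<eta> * (Sup K - Inf K))"
        by (intro sum.cong) (auto simp: P_def err_def)
      also have "\<dots> \<le> (\<Sum>(t, K)\<in>p. \<eta> * (Sup K - Inf K))"
        using fin \<eta> K by (intro sum_mono2) (auto simp: P_def, metis atLeastatMost_empty_iff diff_ge_0_iff_ge order_trans less_imp_le mult_nonneg_nonneg)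
      also have "\<dots> = \<eta> * (b - a)"
        by (simp add: total(1) sum_distrib_left case_prod_unfold)
      finally show "norm ((\<Sum>(t, K)\<in>p. measure lborel K *\<^sub>R f0 t) - (f b - f a)) < e"
        using small_var \<eta>(2) by linarith
    qed
  qed
  then show ?thesis
    by (rule has_integral_spike[OF N, rotated]) (auto simp: f0_def)
qed

text \<open>Every closure property below, as well as absolute continuity of \<open>C\<^sup>1\<close> functions, is an instance of this
  comparison of increments.\<close>
lemma absolutely_cont_on_dominated:
  fixes f :: "real \<Rightarrow> 'a::real_normed_vector" and g :: "real \<Rightarrow> 'b::real_normed_vector"
    and h :: "real \<Rightarrow> 'c::real_normed_vector"
  assumes f: "absolutely_cont_on a b f" and g: "absolutely_cont_on a b g" and C: "C \<ge> 0"
    and h: "\<And>u v. \<lbrakk>a \<le> u; u \<le> v; v \<le> b\<rbrakk> \<Longrightarrow> norm (h v - h u) \<le> C * (norm (f v - f u) + norm (g v - g u))"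
  shows "absolutely_cont_on a b h"
  unfolding absolutely_cont_on_def
proof (intro allI impI)
  fix e :: real assume e: "e > 0"
  define e' where "e' = e / (2 * (C + 1))"
  have e': "e' > 0" using e C by (simp add: e'_def)
  obtain d1 where d1: "d1 > 0" "\<And>I. finite I
        \<and> (\<forall>(u, v)\<in>I. a \<le> u \<and> u \<le> v \<and> v \<le> b)
        \<and> disjoint_family_on (\<lambda>(u, v). {u<..<v}) I
        \<and> (\<Sum>(u, v)\<in>I. v - u) < d1
        \<longrightarrow> (\<Sum>(u, v)\<in>I. norm (f v - f u)) < e'"
    using f e' unfolding absolutely_cont_on_def by blast
  obtain d2 where d2: "d2 > 0" "\<And>I. finite I
        \<and> (\<forall>(u, v)\<in>I. a \<le> u \<and> u \<le> v \<and> v \<le> b)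
        \<and> disjoint_family_on (\<lambda>(u, v). {u<..<v}) I
        \<and> (\<Sum>(u, v)\<in>I. v - u) < d2
        \<longrightarrow> (\<Sum>(u, v)\<in>I. norm (g v - g u)) < e'"
    using g e' unfolding absolutely_cont_on_def by blast
  show "\<exists>d>0. \<forall>I. finite I
        \<and> (\<forall>(u, v)\<in>I. a \<le> u \<and> u \<le> v \<and> v \<le> b)
        \<and> disjoint_family_on (\<lambda>(u, v). {u<..<v}) I
        \<and> (\<Sum>(u, v)\<in>I. v - u) < d
        \<longrightarrow> (\<Sum>(u, v)\<in>I. norm (h v - h u)) < e"
  proof (intro exI[of _ "min d1 d2"] conjI allI impI)
    show "min d1 d2 > 0" using d1 d2 by simp
    fix I assume I: "finite I
        \<and> (\<forall>(u, v)\<in>I. a \<le> u \<and> u \<le> v \<and> v \<le> b)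
        \<and> disjoint_family_on (\<lambda>(u, v). {u<..<v}) I
        \<and> (\<Sum>(u, v)\<in>I. v - u) < min d1 d2"
    have "(\<Sum>(u, v)\<in>I. norm (h v - h u)) \<le> (\<Sum>(u, v)\<in>I. C * (norm (f v - f u) + norm (g v - g u)))"
      using I h by (intro sum_mono) auto
    also have "\<dots> = C * ((\<Sum>(u, v)\<in>I. norm (f v - f u)) + (\<Sum>(u, v)\<in>I. norm (g v - g u)))"
      by (simp add: sum_distrib_left sum.distrib case_prod_unfold distrib_left)
    also have "\<dots> \<le> C * (e' + e')"
      using d1(2)[of I] d2(2)[of I] I C by (intro mult_left_mono add_mono) auto
    also have "\<dots> < (C + 1) * (e' + e')" using e' by simp
    also have "\<dots> = (2 * (C + 1)) * e'" by (simp add: algebra_simps)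
    also have "\<dots> = e" using C unfolding e'_def by simp
    finally show "(\<Sum>(u, v)\<in>I. norm (h v - h u)) < e" .
  qed
qed

lemma absolutely_cont_on_ident: "absolutely_cont_on a b (\<lambda>t::real. t)"
  unfolding absolutely_cont_on_def
proof (intro allI impI)
  fix e :: real assume "e > 0"
  then show "\<exists>d>0. \<forall>I. finite I
        \<and> (\<forall>(u, v)\<in>I. a \<le> u \<and> u \<le> v \<and> v \<le> b)
        \<and> disjoint_family_on (\<lambda>(u, v). {u<..<v}) I
        \<and> (\<Sum>(u, v)\<in>I. v - u) < d
        \<longrightarrow> (\<Sum>(u, v)\<in>I. norm (v - u)) < e"
  proof (intro exI[of _ e] conjI allI impI)
    fix I assume I: "finite I
        \<and> (\<forall>(u, v)\<in>I. a \<le> u \<and> u \<le> v \<and> v \<le> b)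
        \<and> disjoint_family_on (\<lambda>(u, v). {u<..<v}) I
        \<and> (\<Sum>(u, v)\<in>I. v - u) < e"
    have "(\<Sum>(u, v)\<in>I. norm (v - u)) = (\<Sum>(u, v)\<in>I. v - u)"
      using I by (intro sum.cong) auto
    then show "(\<Sum>(u, v)\<in>I. norm (v - u)) < e" using I by linarith
  qed
qed

text \<open>The derivative is bounded on the compact interval, so the increments are dominated by those of
  the identity.\<close>
lemma absolutely_cont_on_C1:
  fixes f :: "real \<Rightarrow> 'a::real_normed_vector"
  assumes deriv: "\<And>t. t \<in> {a..b} \<Longrightarrow> (f has_vector_derivative f' t) (at t within {a..b})"
    and cont: "continuous_on {a..b} f'"
  shows "absolutely_cont_on a b f"
proof -
  have "bounded (f' ` {a..b})"
    using compact_continuous_image[OF cont] compact_imp_bounded by blast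
  then obtain M where M: "\<And>t. t \<in> {a..b} \<Longrightarrow> norm (f' t) \<le> M" unfolding bounded_iff by blast
  show ?thesis
  proof (rule absolutely_cont_on_dominated[OF absolutely_cont_on_ident absolutely_cont_on_ident])
    show "\<bar>M\<bar> \<ge> 0" by simp
    fix u v assume uv: "a \<le> u" "u \<le> v" "v \<le> b"
    have "norm (f v - f u) \<le> M * norm (v - u)"
    proof (rule differentiable_bound[where S="{a..b}" and f'="\<lambda>t h. h *\<^sub>R f' t"])
      fix t assume t: "t \<in> {a..b}"
      show "(f has_derivative (\<lambda>h. h *\<^sub>R f' t)) (at t within {a..b})"
        using deriv[OF t] by (simp add: has_vector_derivative_def)
      show "onorm (\<lambda>h. h *\<^sub>R f' t) \<le> M"
      proof (rule onorm_bound)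
        show "0 \<le> M" using M[OF t] norm_ge_zero order_trans by blast
        show "norm (h *\<^sub>R f' t) \<le> M * norm h" for h :: real
          using mult_left_mono[OF M[OF t], of "\<bar>h\<bar>"] by (simp add: mult.commute)
      qed
    qed (use uv in auto)
    also have "\<dots> \<le> \<bar>M\<bar> * (norm (v - u) + norm (v - u))" by (intro mult_mono) auto
    finally show "norm (f v - f u) \<le> \<bar>M\<bar> * (norm (v - u) + norm (v - u))" .
  qed
qed

lemma absolutely_cont_on_add:
  assumes "absolutely_cont_on a b f" "absolutely_cont_on a b g"
  shows "absolutely_cont_on a b (\<lambda>t. f t + g t)"
proof (rule absolutely_cont_on_dominated[OF assms, of 1])
  fix u v show "norm (f v + g v - (f u + g u)) \<le> 1 * (norm (f v - f u) + norm (g v - g u))"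
    by (simp add: add_diff_add norm_triangle_ineq)
qed auto

lemma absolutely_cont_on_Pair:
  assumes "absolutely_cont_on a b f" "absolutely_cont_on a b g"
  shows "absolutely_cont_on a b (\<lambda>t. (f t, g t))"
proof (rule absolutely_cont_on_dominated[OF assms, of 1])
  fix u v show "norm ((f v, g v) - (f u, g u)) \<le> 1 * (norm (f v - f u) + norm (g v - g u))"
    using norm_Pair_le[of "f v - f u" "g v - g u"] by simp
qed auto

lemma absolutely_cont_on_bilinear:
  assumes bil: "bounded_bilinear bop"
    and f: "absolutely_cont_on a b f" "bounded (f ` {a..b})"
    and g: "absolutely_cont_on a b g" "bounded (g ` {a..b})"
  shows "absolutely_cont_on a b (\<lambda>t. bop (f t) (g t))"
proof -
  interpret bounded_bilinear bop by (rule bil)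
  obtain F where F: "\<And>t. t \<in> {a..b} \<Longrightarrow> norm (f t) \<le> F" using f(2) unfolding bounded_iff by blast
  obtain G where G: "\<And>t. t \<in> {a..b} \<Longrightarrow> norm (g t) \<le> G" using g(2) unfolding bounded_iff by blast
  obtain K where K: "K \<ge> 0" "\<And>x y. norm (bop x y) \<le> norm x * norm y * K" using nonneg_bounded by blast
  define C where "C = max \<bar>F\<bar> \<bar>G\<bar> * K"
  show ?thesis
  proof (rule absolutely_cont_on_dominated[OF f(1) g(1)])
    show "C \<ge> 0" using K by (simp add: C_def)
    fix u v assume uv: "a \<le> u" "u \<le> v" "v \<le> b"
    have "bop (f v) (g v) - bop (f u) (g u) = bop (f v - f u) (g v) + bop (f u) (g v - g u)"
      by (simp add: diff_left diff_right)
    also have "norm \<dots> \<le> norm (f v - f u) * norm (g v) * K + norm (f u) * norm (g v - g u) * K"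
      by (meson K add_mono norm_triangle_ineq order_trans)
    also have "\<dots> \<le> norm (f v - f u) * max \<bar>F\<bar> \<bar>G\<bar> * K + max \<bar>F\<bar> \<bar>G\<bar> * norm (g v - g u) * K"
    proof (intro add_mono mult_right_mono mult_left_mono K(1) norm_ge_zero)
      show "norm (g v) \<le> max \<bar>F\<bar> \<bar>G\<bar>" using G[of v] uv by auto
      show "norm (f u) \<le> max \<bar>F\<bar> \<bar>G\<bar>" using F[of u] uv by auto
    qed
    also have "\<dots> = C * (norm (f v - f u) + norm (g v - g u))" by (simp add: C_def algebra_simps)
    finally show "norm (bop (f v) (g v) - bop (f u) (g u)) \<le> C * (norm (f v - f u) + norm (g v - g u))" .
  qed
qed

section \<open>Improper integrals and convexity\<close>

text \<open>The sign condition is required only from \<open>T\<close> on, where the energy estimate is available; the compact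
  piece before \<open>T\<close> is integrable by continuity.\<close>
lemma nonneg_absolutely_integrable_on_halfline:
  fixes f :: "real \<Rightarrow> real"
  assumes cont: "continuous_on {a..} f"
    and nonneg: "\<And>t. t \<ge> T \<Longrightarrow> f t \<ge> 0" and aT: "a \<le> T"
    and bound: "\<And>S. S \<ge> T \<Longrightarrow> integral {T..S} f \<le> M"
  shows "f absolutely_integrable_on {a..}"
proof -
  have int: "f integrable_on {c..d}" if "c \<ge> a" for c d
    using that by (intro integrable_continuous_real continuous_on_subset[OF cont]) auto
  have "f integrable_on {T..} \<and> ((\<lambda>k. integral {T..} (\<lambda>t. if t \<in> {T..T + real k} then f t else 0)) \<longlonglongrightarrow> integral {T..} f)"
  proof (rule monotone_convergence_increasing)
    have eq: "{T..} \<inter> {T..T + real k} = {T..T + real k}" for k by auto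
    show "(\<lambda>t. if t \<in> {T..T + real k} then f t else 0) integrable_on {T..}" for k
      using int[OF aT, of "T + real k"] by (subst integrable_restrict_Int) (simp add: Int_commute eq)
    have val: "integral {T..} (\<lambda>t. if t \<in> {T..T + real k} then f t else 0) = integral {T..T + real k} f" for k
      by (subst integral_restrict_Int) (simp add: Int_commute eq)
    show "bounded (range (\<lambda>k. integral {T..} (\<lambda>t. if t \<in> {T..T + real k} then f t else 0)))"
      unfolding bounded_iff val
    proof (intro exI[of _ M] ballI, clarify)
      fix k
      have "integral {T..T + real k} f \<ge> 0" using nonneg by (intro integral_nonneg int aT) auto
      then show "norm (integral {T..T + real k} f) \<le> M" using bound[of "T + real k"] by simp
    qed
    show "(\<lambda>k. if t \<in> {T..T + real k} then f t else 0) \<longlonglongrightarrow> f t" if "t \<in> {T..}" for t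
    proof (rule tendsto_eventually)
      obtain n where "t - T \<le> real n" using real_arch_simple by blast
      then show "\<forall>\<^sub>F k in sequentially. (if t \<in> {T..T + real k} then f t else 0) = f t"
        using that by (intro eventually_sequentiallyI[of n]) auto
    qed
  qed (use nonneg in auto)
  then have "f absolutely_integrable_on {T..}"
    using nonneg by (intro nonnegative_absolutely_integrable_1) auto
  moreover have "f absolutely_integrable_on {a..T}"
    using aT by (intro absolutely_integrable_continuous_real continuous_on_subset[OF cont]) auto
  ultimately have "f absolutely_integrable_on ({a..T} \<union> {T..})"
    by (rule absolutely_integrable_Un[rotated])
  moreover have "{a..T} \<union> {T..} = {a..}" using aT by auto
  ultimately show ?thesis by simp
qed

lemma GDERIV_grad:
  fixes f :: "'a::euclidean_space \<Rightarrow> real"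
  assumes "f differentiable (at x)"
  shows "GDERIV f x :> grad f x"
proof -
  obtain f' where f': "(f has_derivative f') (at x)" using assms by (auto simp: differentiable_def)
  interpret bounded_linear f' by (rule has_derivative_bounded_linear[OF f'])
  define D where "D = (\<Sum>i\<in>Basis. f' i *\<^sub>R i)"
  have "f' h = h \<bullet> D" for h
  proof -
    have "f' h = f' (\<Sum>i\<in>Basis. (h \<bullet> i) *\<^sub>R i)" by (simp add: euclidean_representation)
    also have "\<dots> = h \<bullet> D" by (simp add: sum scaleR D_def inner_sum_right mult.commute)
    finally show ?thesis .
  qed
  then have D: "GDERIV f x :> D" using f' by (simp add: gderiv_def flip: fun_eq_iff) (metis ext)
  have "D' = D" if "GDERIV f x :> D'" for D'
  proof -
    have "(\<lambda>h. h \<bullet> D') = (\<lambda>h. h \<bullet> D)"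
      using D that unfolding gderiv_def by (rule has_derivative_unique[rotated])
    then have "(D' - D) \<bullet> D' = (D' - D) \<bullet> D" by metis
    then show ?thesis by (metis inner_eq_zero_iff inner_diff_right eq_iff_diff_eq_0)
  qed
  then show ?thesis unfolding grad_def using D by (rule_tac theI2) auto
qed

text \<open>Restricting \<open>f\<close> to the line through \<open>p\<close> and \<open>q\<close> reduces this to the tangent inequality for convex
  functions of one real variable.\<close>
lemma convex_on_above_gradient:
  fixes f :: "'a::euclidean_space \<Rightarrow> real"
  assumes cvx: "convex_on UNIV f" and diff: "f differentiable (at p)"
  shows "f q \<ge> f p + grad f p \<bullet> (q - p)"
proof -
  define \<phi> where "\<phi> s = f (p + s *\<^sub>R (q - p))" for s :: real
  have "convex_on UNIV \<phi>"
  proof (rule convex_onI)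
    fix s u v :: real assume s: "0 < s" "s < 1"
    have "p + ((1 - s) *\<^sub>R u + s *\<^sub>R v) *\<^sub>R (q - p) = (1 - s) *\<^sub>R (p + u *\<^sub>R (q - p)) + s *\<^sub>R (p + v *\<^sub>R (q - p))"
      by (simp add: algebra_simps)
    then show "\<phi> ((1 - s) *\<^sub>R u + s *\<^sub>R v) \<le> (1 - s) * \<phi> u + s * \<phi> v"
      unfolding \<phi>_def using convex_onD[OF cvx, of s "p + u *\<^sub>R (q - p)" "p + v *\<^sub>R (q - p)"] s by simp
  qed simp
  moreover have "(\<phi> has_real_derivative grad f p \<bullet> (q - p)) (at 0)"
  proof -
    have "(f has_derivative (\<lambda>h. h \<bullet> grad f p)) (at (p + 0 *\<^sub>R (q - p)))"
      using GDERIV_grad[OF diff] by (simp add: gderiv_def)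
    then have "(\<phi> has_derivative (\<lambda>h. (h *\<^sub>R (q - p)) \<bullet> grad f p)) (at 0)"
      unfolding \<phi>_def by (rule has_derivative_compose[rotated]) (auto intro!: derivative_eq_intros)
    moreover have "(\<lambda>h. (h *\<^sub>R (q - p)) \<bullet> grad f p) = (*) (grad f p \<bullet> (q - p))"
      by (simp add: fun_eq_iff inner_commute mult.commute)
    ultimately show ?thesis by (simp add: has_field_derivative_def)
  qed
  ultimately have "\<phi> 1 - \<phi> 0 \<ge> (grad f p \<bullet> (q - p)) * (1 - 0)"
    by (intro convex_on_imp_above_tangent[where A = UNIV]) auto
  then show ?thesis by (simp add: \<phi>_def)
qed

section \<open>Lyapunov analysis of inertial dynamics with skew coupling\<close>

text \<open>The dynamical system seen from the saddle point: \<open>z\<close> is the deviation of the trajectory from the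
  saddle point and \<open>w\<close> its velocity, \<open>G\<close> is the gap of the augmented Lagrangian with gradient \<open>DG\<close>, and \<open>K\<close>
  is the coupling of the primal variables with the multiplier, evaluated at the extrapolated point
  \<open>z + \<delta> w\<close>. The coupling does no work and so drops out of the energy balance. Convexity enters through
  \<open>DG_inner\<close>: besides the usual \<open>DG p \<bullet> p \<ge> G p\<close>, the quadratic penalty leaves an extra term \<open>Q\<close>, which
  becomes half the squared residual. The null set \<open>N\<close> collects the times at which the equation may fail,
  and \<open>\<kappa>\<close> is an integrable bound of the weighted perturbation.\<close>
locale skew_inertial_flow =
  fixes z w \<epsilon> :: "real \<Rightarrow> 'a::euclidean_space"
    and DG K :: "'a \<Rightarrow> 'a" and G Q :: "'a \<Rightarrow> real"
    and \<kappa> :: "real \<Rightarrow> real" and N :: "real set"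
    and t0 \<alpha> r r0 :: real
  assumes t0: "t0 \<ge> 1" and r: "0 \<le> r" "r < 1" and \<alpha>: "\<alpha> > 0" and r0: "r0 > r"
    and z_deriv: "\<And>t. t \<ge> t0 \<Longrightarrow> (z has_vector_derivative w t) (at t within {t0..})"
    and w_cont: "continuous_on {t0..} w"
    and w_ac: "\<And>a b. \<lbrakk>t0 \<le> a; a \<le> b\<rbrakk> \<Longrightarrow> absolutely_cont_on a b w"
    and N: "negligible N"
    and w_deriv: "\<And>t. \<lbrakk>t \<ge> t0; t \<notin> N\<rbrakk> \<Longrightarrow> (w has_vector_derivative
        K (z t + (t / (2 * r0)) *\<^sub>R w t) - DG (z t) - (\<alpha> / t powr r) *\<^sub>R w t + \<epsilon> t) (at t within {t0..})"
    and skew: "\<And>p. K p \<bullet> p = 0"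
    and G_deriv: "\<And>p. (G has_derivative (\<lambda>h. DG p \<bullet> h)) (at p)"
    and DG_cont: "continuous_on UNIV DG" and Q_cont: "continuous_on UNIV Q"
    and G_nonneg: "\<And>p. G p \<ge> 0" and Q_nonneg: "\<And>p. Q p \<ge> 0"
    and DG_inner: "\<And>p. DG p \<bullet> p \<ge> G p + Q p"
    and \<kappa>_int: "\<kappa> integrable_on {t0..}"
    and \<kappa>_bound: "\<And>t. t \<ge> t0 \<Longrightarrow> t powr r * norm (\<epsilon> t) \<le> \<kappa> t"
begin

text \<open>The coefficient \<open>\<rho> = 2 r\<^sub>0 t\<^sup>r\<^sup>-\<^sup>1\<close> is chosen so that \<open>v = \<rho> z + t\<^sup>r w\<close> equals \<open>\<rho> (z + \<delta> w)\<close> with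
  \<open>\<delta> = t / (2 r\<^sub>0)\<close>: then \<open>v\<close> is orthogonal to the coupling term. The coefficient \<open>\<xi>\<close> is the one for which
  the derivative of \<open>\<xi> (z \<bullet> z)\<close> cancels all the mixed terms \<open>z \<bullet> w\<close> arising from \<open>v \<bullet> v\<close>.\<close>
definition "\<rho> t = 2 * r0 * t powr (r - 1)"
definition "v t = \<rho> t *\<^sub>R z t + t powr r *\<^sub>R w t"
definition "\<xi> t = 2 * r0 * (\<alpha> * t powr (r - 1) - (2 * r + 2 * r0 - 1) * t powr (2 * r - 2))"
definition "energy t = 2 * (t powr (2 * r) * G (z t)) + \<xi> t * (z t \<bullet> z t) + v t \<bullet> v t"
definition "dissipation t = 2 * (r0 - r) * (t powr (2 * r - 1) * G (z t))
    + 2 * r0 * (t powr (2 * r - 1) * Q (z t)) + \<alpha> / 2 * (t powr r * (norm (w t))\<^sup>2)"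

text \<open>From a late time on, the friction \<open>\<alpha> t\<^sup>-\<^sup>r\<close> dominates the terms of order \<open>t\<^sup>-\<^sup>1\<close>. The first condition
  leaves at least half of the kinetic dissipation, the second makes \<open>\<xi>\<close> positive and nonincreasing.\<close>
definition "late T \<longleftrightarrow> T \<ge> t0 \<and> (\<forall>t\<ge>T. (2 * r0 + r) * t powr (r - 1) \<le> \<alpha> / 2
    \<and> 2 * \<bar>2 * r + 2 * r0 - 1\<bar> * t powr (r - 1) \<le> \<alpha>)"

lemma r0_pos: "r0 > 0" using r r0 by simp

text \<open>Since \<open>r < 1\<close>, the factor \<open>t\<^sup>r\<^sup>-\<^sup>1\<close> tends to zero.\<close>
lemma late_exists: "\<exists>T. late T"
proof -
  have lim: "((\<lambda>t::real. c * t powr (r - 1)) \<longlongrightarrow> 0) at_top" for c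
    using tendsto_mult_right_zero[OF tendsto_neg_powr[OF _ filterlim_ident, of "r - 1"], of c] r by simp
  have "eventually (\<lambda>t. (2 * r0 + r) * t powr (r - 1) < \<alpha> / 2
      \<and> 2 * \<bar>2 * r + 2 * r0 - 1\<bar> * t powr (r - 1) < \<alpha>) at_top"
    using \<alpha> by (intro eventually_conj order_tendstoD(2)[OF lim]) auto
  then obtain T where "\<And>t. t \<ge> T \<Longrightarrow> (2 * r0 + r) * t powr (r - 1) < \<alpha> / 2
      \<and> 2 * \<bar>2 * r + 2 * r0 - 1\<bar> * t powr (r - 1) < \<alpha>"
    unfolding eventually_at_top_linorder by blast
  then show ?thesis unfolding late_def by (intro exI[of _ "max T t0"]) (auto intro: less_imp_le)
qed

text \<open>All powers of \<open>t\<close> in the energy and its derivative are monomials in \<open>t\<close> and \<open>q = t\<^sup>r\<^sup>-\<^sup>1\<close>. Written in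
  this way, identities between them become polynomial identities.\<close>
lemma powr_laws:
  assumes "t > 0"
  shows "t powr r = t * t powr (r - 1)" "t powr (2 * r) = (t * t powr (r - 1))\<^sup>2"
    "t powr (2 * r - 1) = t * (t powr (r - 1))\<^sup>2" "t powr (2 * r - 2) = (t powr (r - 1))\<^sup>2"
    "t powr (r - 2) = t powr (r - 1) / t" "t powr (2 * r - 3) = (t powr (r - 1))\<^sup>2 / t"
proof -
  have sq: "(t powr (r - 1))\<^sup>2 = t powr (2 * r - 2)"
    using assms by (simp add: power2_eq_square flip: powr_add)
  have up: "t * t powr a = t powr (a + 1)" and down: "t powr a / t = t powr (a - 1)" for a
    using assms by (simp_all add: powr_add powr_diff)
  show "t powr r = t * t powr (r - 1)" "t powr (2 * r) = (t * t powr (r - 1))\<^sup>2"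
    "t powr (2 * r - 1) = t * (t powr (r - 1))\<^sup>2" "t powr (2 * r - 2) = (t powr (r - 1))\<^sup>2"
    "t powr (r - 2) = t powr (r - 1) / t" "t powr (2 * r - 3) = (t powr (r - 1))\<^sup>2 / t"
    using assms by (simp_all add: sq up down power_mult_distrib)
      (simp_all add: power2_eq_square flip: powr_add)
qed

lemma powr_vector_derivative:
  "t > 0 \<Longrightarrow> ((\<lambda>s::real. s powr a) has_vector_derivative a * t powr (a - 1)) (at t within S)"
  by (auto intro!: derivative_eq_intros simp flip: has_real_derivative_iff_has_vector_derivative)

lemma z_cont: "continuous_on {t0..} z"
  unfolding continuous_on_eq_continuous_within
  using z_deriv[THEN has_vector_derivative_continuous] by simp

lemma G_cont: "continuous_on UNIV G"
  using G_deriv by (intro continuous_at_imp_continuous_on ballI has_derivative_continuous)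

lemma comp_z_cont: "continuous_on UNIV F \<Longrightarrow> continuous_on {t0..} (\<lambda>t. F (z t))"
  using continuous_on_compose2[of UNIV F "{t0..}" z] z_cont by auto

lemmas G_z_cont = comp_z_cont[OF G_cont] and Q_z_cont = comp_z_cont[OF Q_cont]
  and DG_z_cont = comp_z_cont[OF DG_cont]

lemma t_pos: "t \<ge> t0 \<Longrightarrow> t > 0" using t0 by simp

lemma powr_cont: "continuous_on {t0..} (\<lambda>t::real. t powr a)"
  using t_pos by (intro continuous_intros) auto

text \<open>\<open>\<rho>'\<close> and \<open>\<xi>'\<close> are the derivatives of \<open>\<rho>\<close> and \<open>\<xi>\<close>, and \<open>C1_energy_rate\<close> is the derivative of the part of
  the energy that does not involve the velocity and is therefore continuously differentiable.\<close>
definition "\<rho>' t = 2 * r0 * ((r - 1) * t powr (r - 2))"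
definition "\<xi>' t = 2 * r0 * (\<alpha> * ((r - 1) * t powr (r - 2)) - (2 * r + 2 * r0 - 1) * ((2 * r - 2) * t powr (2 * r - 3)))"
definition "C1_energy_rate t = 2 * (t powr (2 * r) * (DG (z t) \<bullet> w t) + 2 * r * t powr (2 * r - 1) * G (z t))
  + (\<xi> t * (2 * (z t \<bullet> w t)) + \<xi>' t * (z t \<bullet> z t))"

lemma C1_energy_deriv:
  assumes t: "t \<ge> t0"
  shows "((\<lambda>t. 2 * (t powr (2 * r) * G (z t)) + \<xi> t * (z t \<bullet> z t)) has_vector_derivative C1_energy_rate t) (at t within {t0..})"
proof -
  have Gz: "((\<lambda>t. G (z t)) has_vector_derivative DG (z t) \<bullet> w t) (at t within {t0..})"
    unfolding has_vector_derivative_def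
    using has_derivative_compose[OF z_deriv[OF t, unfolded has_vector_derivative_def] G_deriv] by simp
  have zz: "((\<lambda>t. z t \<bullet> z t) has_vector_derivative 2 * (z t \<bullet> w t)) (at t within {t0..})"
    using bounded_bilinear.has_vector_derivative[OF bounded_bilinear_inner z_deriv[OF t] z_deriv[OF t]]
    by (simp add: inner_commute)
  have p: "((\<lambda>s::real. s powr a) has_vector_derivative a * t powr (a - 1)) (at t within {t0..})" for a
    using t_pos[OF t] by (rule powr_vector_derivative)
  have \<xi>: "(\<xi> has_vector_derivative \<xi>' t) (at t within {t0..})"
    unfolding \<xi>_def[abs_def] \<xi>'_def
    by (intro has_vector_derivative_mult_right has_vector_derivative_diff)
      (use p[of "r - 1"] p[of "2 * r - 2"] in simp_all)
  show ?thesis unfolding C1_energy_rate_def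
    by (intro has_vector_derivative_add has_vector_derivative_mult_right has_vector_derivative_mult Gz zz \<xi> p)
qed

lemma \<xi>_cont: "continuous_on {t0..} \<xi>" and \<xi>'_cont: "continuous_on {t0..} \<xi>'"
  and \<rho>_cont: "continuous_on {t0..} \<rho>" and \<rho>'_cont: "continuous_on {t0..} \<rho>'"
  unfolding \<xi>_def[abs_def] \<xi>'_def[abs_def] \<rho>_def[abs_def] \<rho>'_def[abs_def]
  by (intro continuous_intros powr_cont)+

lemma C1_energy_rate_cont: "continuous_on {t0..} C1_energy_rate"
  unfolding C1_energy_rate_def[abs_def]
  by (intro continuous_intros powr_cont \<xi>_cont \<xi>'_cont DG_z_cont G_z_cont w_cont z_cont)

lemma v_cont: "continuous_on {t0..} v"
  unfolding v_def[abs_def] by (intro continuous_intros powr_cont \<rho>_cont z_cont w_cont)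

lemma dissipation_cont: "continuous_on {t0..} dissipation"
  unfolding dissipation_def[abs_def]
  by (intro continuous_intros powr_cont G_z_cont Q_z_cont w_cont)

lemma \<rho>_deriv: "t \<ge> t0 \<Longrightarrow> (\<rho> has_vector_derivative \<rho>' t) (at t within {t0..})"
  unfolding \<rho>_def[abs_def] \<rho>'_def using powr_vector_derivative[OF t_pos, of t "r - 1"]
  by (intro has_vector_derivative_mult_right) simp

lemma C1_halfline_ac:
  assumes "\<And>t. t \<ge> t0 \<Longrightarrow> (h has_vector_derivative h' t) (at t within {t0..})"
    and "continuous_on {t0..} h'" and "t0 \<le> a"
  shows "absolutely_cont_on a b h"
proof (rule absolutely_cont_on_C1)
  show "continuous_on {a..b} h'" using assms(2,3) by (auto intro: continuous_on_subset)
  show "(h has_vector_derivative h' t) (at t within {a..b})" if "t \<in> {a..b}" for t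
    using that assms(3) by (intro has_vector_derivative_within_subset[OF assms(1)]) auto
qed

lemma bounded_on_interval:
  fixes h :: "real \<Rightarrow> 'b::real_normed_vector"
  assumes "continuous_on {t0..} h" "t0 \<le> a" shows "bounded (h ` {a..b})"
  using assms by (intro compact_imp_bounded compact_continuous_image continuous_on_subset[OF assms(1)]) auto

text \<open>The velocity enters the energy only through \<open>v \<bullet> v\<close>, a bilinear expression in absolutely continuous
  functions.\<close>
lemma energy_ac:
  assumes ab: "t0 \<le> a" "a \<le> b"
  shows "absolutely_cont_on a b energy"
proof -
  have "absolutely_cont_on a b (\<lambda>t. \<rho> t *\<^sub>R z t)"
    by (intro absolutely_cont_on_bilinear[OF bounded_bilinear_scaleR] bounded_on_interval
        \<rho>_cont z_cont C1_halfline_ac[OF \<rho>_deriv \<rho>'_cont] C1_halfline_ac[OF z_deriv w_cont] ab)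
  moreover have "absolutely_cont_on a b (\<lambda>t. t powr r *\<^sub>R w t)"
    using t_pos by (intro absolutely_cont_on_bilinear[OF bounded_bilinear_scaleR] bounded_on_interval
        powr_cont w_cont C1_halfline_ac[OF powr_vector_derivative] w_ac ab continuous_intros) auto
  ultimately have v: "absolutely_cont_on a b v"
    unfolding v_def[abs_def] by (rule absolutely_cont_on_add)
  show ?thesis unfolding energy_def[abs_def]
    by (intro absolutely_cont_on_add C1_halfline_ac[OF C1_energy_deriv C1_energy_rate_cont] ab
        absolutely_cont_on_bilinear[OF bounded_bilinear_inner] v bounded_on_interval v_cont)
qed

lemma \<xi>_lower:
  assumes "late T" "t \<ge> T"
  shows "\<xi> t \<ge> r0 * \<alpha> * t powr (r - 1)"
proof -
  define q where "q = t powr (r - 1)"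
  have t: "t > 0" using assms t_pos by (auto simp: late_def)
  have q: "q > 0" using t by (simp add: q_def)
  have "2 * \<bar>2 * r + 2 * r0 - 1\<bar> * q \<le> \<alpha>" using assms by (auto simp: late_def q_def)
  then have "(2 * r + 2 * r0 - 1) * q \<le> \<alpha> / 2"
    using mult_right_mono[OF abs_ge_self[of "2 * r + 2 * r0 - 1"], of q] q by linarith
  then have "r0 * q * (\<alpha> / 2) \<le> r0 * q * (\<alpha> - (2 * r + 2 * r0 - 1) * q)"
    using q r0_pos by (intro mult_left_mono) auto
  then show ?thesis
    unfolding \<xi>_def powr_laws(4)[OF t] q_def[symmetric] by (simp add: algebra_simps power2_eq_square)
qed

text \<open>The Lyapunov estimate. In \<open>v \<bullet> v'\<close> the coupling term vanishes, and the contribution \<open>-t\<^sup>2\<^sup>r (DG z \<bullet> w)\<close>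
  of the gradient is cancelled by the derivative of \<open>t\<^sup>2\<^sup>r G (z t)\<close>. The remaining gradient term
  \<open>-t\<^sup>r \<rho> (DG z \<bullet> z)\<close> is at most \<open>-2 r\<^sub>0 t\<^sup>2\<^sup>r\<^sup>-\<^sup>1 (G + Q)\<close>, and since \<open>r\<^sub>0 > r\<close> it outweighs the growth
  \<open>2 r t\<^sup>2\<^sup>r\<^sup>-\<^sup>1 G\<close> of the weight.\<close>
lemma energy_rate:
  assumes late: "late T" and tT: "t \<ge> T" and tN: "t \<notin> N"
  obtains e' where "(energy has_vector_derivative e') (at t within {t0..})"
    "e' \<le> - 2 * dissipation t + 2 * (\<kappa> t * norm (v t))"
proof -
  have tt0: "t \<ge> t0" using late tT by (simp add: late_def)
  then have t: "t > 0" by (rule t_pos)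
  define q where "q = t powr (r - 1)"
  have q: "q > 0" using t by (simp add: q_def)
  note laws = powr_laws[OF t, folded q_def]
  define dw where "dw = K (z t + (t / (2 * r0)) *\<^sub>R w t) - DG (z t) - (\<alpha> / t powr r) *\<^sub>R w t + \<epsilon> t"
  define dv where "dv = (\<rho> t *\<^sub>R w t + \<rho>' t *\<^sub>R z t) + (t powr r *\<^sub>R dw + (r * t powr (r - 1)) *\<^sub>R w t)"
  have wd: "(w has_vector_derivative dw) (at t within {t0..})"
    unfolding dw_def using w_deriv[OF tt0 tN] .
  have vd: "(v has_vector_derivative dv) (at t within {t0..})"
    unfolding v_def[abs_def] dv_def
    by (intro has_vector_derivative_add bounded_bilinear.has_vector_derivative[OF bounded_bilinear_scaleR]
        \<rho>_deriv z_deriv tt0 wd powr_vector_derivative t)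
  have "(energy has_vector_derivative C1_energy_rate t + (v t \<bullet> dv + dv \<bullet> v t)) (at t within {t0..})"
    unfolding energy_def[abs_def]
    by (intro has_vector_derivative_add bounded_bilinear.has_vector_derivative[OF bounded_bilinear_inner]
        C1_energy_deriv tt0 vd)
  moreover have "C1_energy_rate t + (v t \<bullet> dv + dv \<bullet> v t) \<le> - 2 * dissipation t + 2 * (\<kappa> t * norm (v t))"
  proof -
    define Kp where "Kp = K (z t + (t / (2 * r0)) *\<^sub>R w t)"
    have v: "v t = \<rho> t *\<^sub>R (z t + (t / (2 * r0)) *\<^sub>R w t)"
      using r0_pos by (simp add: v_def \<rho>_def laws q_def[symmetric] algebra_simps)
    have Kv: "v t \<bullet> Kp = 0"
      unfolding v Kp_def using skew by (simp add: inner_commute)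
    define zz zw ww Dz Dw where "zz = z t \<bullet> z t" and "zw = z t \<bullet> w t" and "ww = w t \<bullet> w t"
      and "Dz = DG (z t) \<bullet> z t" and "Dw = DG (z t) \<bullet> w t"
    note abbr = zz_def[symmetric] zw_def[symmetric] ww_def[symmetric] Dz_def[symmetric] Dw_def[symmetric]
    have "dv = \<rho>' t *\<^sub>R z t + (\<rho> t + r * q - \<alpha>) *\<^sub>R w t - (t * q) *\<^sub>R DG (z t) + (t * q) *\<^sub>R Kp + (t * q) *\<^sub>R \<epsilon> t"
      using t q unfolding dv_def dw_def Kp_def[symmetric] laws(1) q_def[symmetric]
      by (simp add: algebra_simps)
    then have "v t \<bullet> dv = v t \<bullet> (\<rho>' t *\<^sub>R z t + (\<rho> t + r * q - \<alpha>) *\<^sub>R w t - (t * q) *\<^sub>R DG (z t))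
        + t * q * (v t \<bullet> \<epsilon> t)"
      using Kv by (simp add: inner_add_right)
    also have "v t \<bullet> (\<rho>' t *\<^sub>R z t + (\<rho> t + r * q - \<alpha>) *\<^sub>R w t - (t * q) *\<^sub>R DG (z t))
        = \<rho> t * \<rho>' t * zz + (\<rho> t * (\<rho> t + r * q - \<alpha>) + t * q * \<rho>' t) * zw
          + t * q * (\<rho> t + r * q - \<alpha>) * ww - t * q * \<rho> t * Dz - (t * q)\<^sup>2 * Dw"
      unfolding v_def laws(1)
      by (simp add: inner_add_left inner_add_right inner_diff_right inner_commute[of "w t" "z t"]
          inner_commute[of _ "DG (z t)"] abbr algebra_simps power2_eq_square)
    also have "\<rho> t * (\<rho> t + r * q - \<alpha>) + t * q * \<rho>' t = - \<xi> t"
      using t unfolding \<rho>_def \<rho>'_def \<xi>_def laws q_def[symmetric] by (simp add: field_simps power2_eq_square)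
    finally have vdv: "v t \<bullet> dv = \<rho> t * \<rho>' t * zz - \<xi> t * zw
          + t * q * (\<rho> t + r * q - \<alpha>) * ww - t * q * \<rho> t * Dz - (t * q)\<^sup>2 * Dw + t * q * (v t \<bullet> \<epsilon> t)" by simp
    \<comment> \<open>It remains to estimate the perturbation, the terms in \<open>z \<bullet> z\<close>, the kinetic term and the gradient
      term, in this order.\<close>
    have eps: "t * q * (v t \<bullet> \<epsilon> t) \<le> \<kappa> t * norm (v t)"
    proof -
      have "t * q * (v t \<bullet> \<epsilon> t) \<le> t * q * (norm (v t) * norm (\<epsilon> t))"
        using t q norm_cauchy_schwarz by (intro mult_left_mono) auto
      also have "\<dots> = (t powr r * norm (\<epsilon> t)) * norm (v t)" by (simp add: laws)
      also have "\<dots> \<le> \<kappa> t * norm (v t)" by (intro mult_right_mono \<kappa>_bound tt0) auto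
      finally show ?thesis .
    qed
    have zz: "2 * (\<rho> t * \<rho>' t * zz) + \<xi>' t * zz \<le> 0"
    proof -
      have b: "2 * \<bar>2 * r + 2 * r0 - 1\<bar> * q \<le> \<alpha>" using late tT by (auto simp: late_def q_def)
      have "2 * (2 * r + 2 * r0 - 1) * q \<le> 2 * \<bar>2 * r + 2 * r0 - 1\<bar> * q"
        using q abs_ge_self[of "2 * r + 2 * r0 - 1"] by (intro mult_right_mono mult_left_mono) auto
      then have b': "\<alpha> - 2 * (2 * r + 2 * r0 - 1) * q \<ge> 0" using b by linarith
      have "\<xi>' t = - (2 * r0 * (1 - r) * (q / t) * (\<alpha> - 2 * (2 * r + 2 * r0 - 1) * q))"
        using t unfolding \<xi>'_def laws by (simp add: field_simps power2_eq_square)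
      also have "\<dots> \<le> 0" using b' t q r r0_pos by simp
      finally have "\<xi>' t \<le> 0" .
      moreover have "\<rho> t * \<rho>' t = - (4 * r0\<^sup>2 * (1 - r) * q\<^sup>2 / t)"
        using t unfolding \<rho>_def \<rho>'_def laws q_def[symmetric] by (simp add: field_simps power2_eq_square)
      then have "\<rho> t * \<rho>' t \<le> 0" using t r by simp
      ultimately have "(2 * (\<rho> t * \<rho>' t) + \<xi>' t) * zz \<le> 0" by (intro mult_nonpos_nonneg) (auto simp: zz_def)
      then show ?thesis by (simp add: algebra_simps)
    qed
    have ww: "t * q * (\<rho> t + r * q - \<alpha>) * ww \<le> - (\<alpha> / 2 * (t * q * ww))"
    proof -
      have "\<rho> t + r * q - \<alpha> \<le> - \<alpha> / 2"
        using late tT by (auto simp: late_def \<rho>_def q_def algebra_simps)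
      then have "(t * q * ww) * (\<rho> t + r * q - \<alpha>) \<le> (t * q * ww) * (- \<alpha> / 2)"
        using t q by (intro mult_left_mono) (auto simp: ww_def)
      then show ?thesis by (simp add: algebra_simps)
    qed
    have "t * q * \<rho> t * (G (z t) + Q (z t)) \<le> t * q * \<rho> t * Dz"
      using t q r0_pos DG_inner[of "z t"] by (intro mult_left_mono) (auto simp: Dz_def \<rho>_def)
    then have Dz: "2 * r0 * (t * q\<^sup>2 * G (z t)) + 2 * r0 * (t * q\<^sup>2 * Q (z t)) \<le> t * q * \<rho> t * Dz"
      unfolding \<rho>_def q_def[symmetric] by (simp add: algebra_simps power2_eq_square)
    have "dissipation t = 2 * r0 * (t * q\<^sup>2 * G (z t)) - 2 * r * (t * q\<^sup>2 * G (z t))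
        + 2 * r0 * (t * q\<^sup>2 * Q (z t)) + \<alpha> / 2 * (t * q * ww)"
      unfolding dissipation_def laws ww_def power2_norm_eq_inner by (simp add: algebra_simps)
    moreover have "C1_energy_rate t = 2 * ((t * q)\<^sup>2 * Dw) + 2 * (2 * r * (t * q\<^sup>2 * G (z t))) + 2 * (\<xi> t * zw) + \<xi>' t * zz"
      unfolding C1_energy_rate_def laws abbr by (simp add: algebra_simps)
    ultimately show ?thesis
      using vdv eps zz ww Dz inner_commute[of dv "v t"] by argo
  qed
  ultimately show thesis using that by blast
qed

lemma dissipation_nonneg: "t \<ge> t0 \<Longrightarrow> dissipation t \<ge> 0"
  unfolding dissipation_def using r0 r0_pos \<alpha> G_nonneg Q_nonneg t_pos
  by (intro add_nonneg_nonneg mult_nonneg_nonneg) auto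

lemma \<kappa>_nonneg: "t \<ge> t0 \<Longrightarrow> \<kappa> t \<ge> 0"
  using \<kappa>_bound[of t] by (meson mult_nonneg_nonneg norm_ge_zero order_trans powr_ge_zero)

lemma energy_balance:
  assumes late: "late T" and TS: "T \<le> S" and M: "\<And>t. t \<in> {T..S} \<Longrightarrow> norm (v t) \<le> M"
  shows "energy S + 2 * integral {T..S} dissipation \<le> energy T + 2 * M * integral {t0..} \<kappa>"
proof -
  have T: "t0 \<le> T" using late by (simp add: late_def)
  have M0: "M \<ge> 0" using order_trans[OF norm_ge_zero M[of T]] TS by simp
  define \<psi> where "\<psi> t = - 2 * dissipation t + 2 * M * \<kappa> t" for t
  have dint: "dissipation integrable_on {T..S}"
    using T by (intro integrable_continuous_real continuous_on_subset[OF dissipation_cont]) auto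
  have kint: "\<kappa> integrable_on {T..S}"
    using T by (intro integrable_on_subinterval[OF \<kappa>_int]) auto
  have \<psi>: "(\<psi> has_integral (- 2 * integral {T..S} dissipation + 2 * M * integral {T..S} \<kappa>)) {T..S}"
    unfolding \<psi>_def by (intro has_integral_add has_integral_mult_right integrable_integral dint kint)
  have "\<exists>e'. t \<ge> T \<longrightarrow> t \<notin> N \<longrightarrow> (energy has_vector_derivative e') (at t within {t0..}) \<and>
        e' \<le> - 2 * dissipation t + 2 * (\<kappa> t * norm (v t))" for t
    using energy_rate[OF late, of t] by metis
  then obtain e' where e': "\<And>t. \<lbrakk>t \<ge> T; t \<notin> N\<rbrakk> \<Longrightarrow> (energy has_vector_derivative e' t) (at t within {t0..})"
    "\<And>t. \<lbrakk>t \<ge> T; t \<notin> N\<rbrakk> \<Longrightarrow> e' t \<le> - 2 * dissipation t + 2 * (\<kappa> t * norm (v t))" by metis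
  \<comment> \<open>On the null set the derivative of the energy is replaced by its bound \<open>\<psi>\<close>, so that the comparison
    of integrands below holds everywhere.\<close>
  have "((\<lambda>t. if t \<in> N then \<psi> t else e' t) has_integral (energy S - energy T)) {T..S}"
  proof (rule absolutely_cont_on_fundamental_theorem[OF TS energy_ac[OF T TS] N])
    fix t assume t: "t \<in> {T..S} - N"
    then have "(energy has_vector_derivative e' t) (at t within {T..S})"
      using T by (intro has_vector_derivative_within_subset[OF e'(1)]) auto
    then show "(energy has_vector_derivative (if t \<in> N then \<psi> t else e' t)) (at t within {T..S})"
      using t by simp
  qed
  then have "energy S - energy T \<le> - 2 * integral {T..S} dissipation + 2 * M * integral {T..S} \<kappa>"
  proof (rule has_integral_le[OF _ \<psi>])
    fix t assume t: "t \<in> {T..S}"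
    have "\<kappa> t * norm (v t) \<le> \<kappa> t * M" using \<kappa>_nonneg[of t] M[OF t] t T by (intro mult_left_mono) auto
    then show "(if t \<in> N then \<psi> t else e' t) \<le> \<psi> t"
      using e'(2)[of t] t by (auto simp: \<psi>_def algebra_simps)
  qed
  moreover have "2 * M * integral {T..S} \<kappa> \<le> 2 * M * integral {t0..} \<kappa>"
    using T M0 \<kappa>_nonneg kint \<kappa>_int by (intro mult_left_mono integral_subset_le) auto
  ultimately show ?thesis by linarith
qed

lemma energy_parts:
  assumes "late T" "t \<ge> T"
  shows "2 * (t powr (2 * r) * G (z t)) \<le> energy t" "\<xi> t * (z t \<bullet> z t) \<le> energy t" "(norm (v t))\<^sup>2 \<le> energy t" "0 \<le> energy t"
proof -
  have "\<xi> t \<ge> 0" using \<xi>_lower[OF assms] r0_pos \<alpha> by (meson mult_nonneg_nonneg less_imp_le order_trans powr_ge_zero)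
  then have "\<xi> t * (z t \<bullet> z t) \<ge> 0" "t powr (2 * r) * G (z t) \<ge> 0" using G_nonneg by simp_all
  then show "2 * (t powr (2 * r) * G (z t)) \<le> energy t" "\<xi> t * (z t \<bullet> z t) \<le> energy t"
    "(norm (v t))\<^sup>2 \<le> energy t" "0 \<le> energy t"
    unfolding energy_def power2_norm_eq_inner using inner_ge_zero[of "v t"] by linarith+
qed

text \<open>The perturbation enters the energy balance only linearly in \<open>v\<close>, while the energy controls \<open>v\<close>
  quadratically. Comparing the two at a point where the norm of \<open>v\<close> is maximal on \<open>[T, S]\<close> gives a bound
  independent of \<open>S\<close>.\<close>
lemma bounded_energy:
  assumes late: "late T"
  obtains C where "\<And>t. t \<ge> T \<Longrightarrow> energy t \<le> C" "\<And>t. t \<ge> T \<Longrightarrow> norm (v t) \<le> C"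
    "\<And>t. t \<ge> T \<Longrightarrow> integral {T..t} dissipation \<le> C"
proof -
  have T: "t0 \<le> T" using late by (simp add: late_def)
  define k where "k = integral {t0..} \<kappa>"
  have k: "k \<ge> 0" unfolding k_def using \<kappa>_nonneg by (intro integral_nonneg \<kappa>_int) auto
  define C1 where "C1 = energy T + 2 * k + 1"
  have ET: "energy T \<ge> 0" using energy_parts[OF late] by simp
  have dn: "integral {T..S} dissipation \<ge> 0" for S
    using T dissipation_nonneg
    by (intro integral_nonneg integrable_continuous_real continuous_on_subset[OF dissipation_cont]) auto
  have vb: "norm (v S) \<le> C1" if S: "S \<ge> T" for S
  proof -
    have "continuous_on {T..S} (\<lambda>t. norm (v t))"
      using T by (intro continuous_on_norm continuous_on_subset[OF v_cont]) auto
    then obtain s where s: "s \<in> {T..S}" "\<And>t. t \<in> {T..S} \<Longrightarrow> norm (v t) \<le> norm (v s)"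
      using continuous_attains_sup[of "{T..S}" "\<lambda>t. norm (v t)"] S by auto
    define M where "M = norm (v s)"
    have "energy s + 2 * integral {T..s} dissipation \<le> energy T + 2 * M * k"
      unfolding k_def M_def using s by (intro energy_balance[OF late]) auto
    then have M2: "M\<^sup>2 \<le> energy T + 2 * M * k"
      using energy_parts(3)[OF late, of s] s(1) dn[of s] by (simp add: M_def)
    have "M \<le> C1"
    proof (rule ccontr)
      \<comment> \<open>If \<open>M \<ge> 1\<close>, dividing \<open>M\<^sup>2 \<le> E + 2 M k\<close> by \<open>M\<close> gives \<open>M \<le> E + 2 k\<close>.\<close>
      assume "\<not> M \<le> C1"
      then have M: "M > C1" "M \<ge> 1" using ET k by (auto simp: C1_def)
      have "M * C1 < M * M" using M by (intro mult_strict_left_mono) auto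
      moreover have "energy T * 1 \<le> energy T * M" using M ET by (intro mult_left_mono) auto
      ultimately show False using M2 M by (simp add: C1_def algebra_simps power2_eq_square)
    qed
    then show ?thesis using s(2)[of S] S by (simp add: M_def)
  qed
  define C where "C = energy T + 2 * C1 * k + C1"
  have C1: "C1 \<ge> 0" using ET k by (simp add: C1_def)
  have bal: "energy S + 2 * integral {T..S} dissipation \<le> energy T + 2 * C1 * k" if "S \<ge> T" for S
    unfolding k_def using vb that by (intro energy_balance[OF late]) auto
  show thesis
  proof (rule that)
    fix t assume t: "t \<ge> T"
    show "energy t \<le> C" using bal[OF t] dn[of t] C1 by (simp add: C_def)
    show "norm (v t) \<le> C" using vb[OF t] ET C1 k by (simp add: C_def add_increasing)
    show "integral {T..t} dissipation \<le> C"
      using bal[OF t] dn[of t] C1 energy_parts(4)[OF late t] by (simp add: C_def)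
  qed
qed

theorem potential_decay: "(\<lambda>t. G (z t)) \<in> O[at_top](\<lambda>t. t powr (- 2 * r))"
proof -
  obtain T where late: "late T" using late_exists by blast
  obtain C where C: "\<And>t. t \<ge> T \<Longrightarrow> energy t \<le> C" using bounded_energy[OF late] by metis
  have "norm (G (z t)) \<le> C * norm (t powr (- 2 * r))" if t: "t \<ge> T" for t
  proof -
    have "t > 0" using t late t_pos by (simp add: late_def)
    moreover have "t powr (2 * r) * G (z t) \<le> C"
      using energy_parts(1,4)[OF late t] C[OF t] by linarith
    ultimately show ?thesis using G_nonneg by (simp add: powr_minus field_simps)
  qed
  then show ?thesis by (intro bigoI[of _ C] eventually_at_top_linorderI[of T])
qed

text \<open>The bound on \<open>v\<close> controls \<open>t\<^sup>r w\<close> up to the term \<open>\<rho> z\<close>. The trajectory itself need not be known to be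
  bounded: the energy bounds \<open>t\<^sup>r\<^sup>-\<^sup>1 (z \<bullet> z)\<close>, which is more than the required \<open>t\<^sup>2\<^sup>r\<^sup>-\<^sup>2 (z \<bullet> z)\<close>.\<close>
theorem velocity_decay: "(\<lambda>t. norm (w t)) \<in> O[at_top](\<lambda>t. t powr (- r))"
proof -
  obtain T where late: "late T" using late_exists by blast
  obtain C where C: "\<And>t. t \<ge> T \<Longrightarrow> energy t \<le> C" "\<And>t. t \<ge> T \<Longrightarrow> norm (v t) \<le> C"
    using bounded_energy[OF late] by metis
  define C' where "C' = C + (1 + 4 * r0 * C / \<alpha>)"
  have "norm (norm (w t)) \<le> C' * norm (t powr (- r))" if t: "t \<ge> T" for t
  proof -
    have tt: "t \<ge> 1" using t late t0 by (simp add: late_def)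
    define q where "q = t powr (r - 1)"
    have q: "q > 0" "q \<le> 1" using tt r powr_mono[of "r - 1" 0 t] by (auto simp: q_def)
    define n where "n = norm (z t)"
    have "r0 * \<alpha> * q * n\<^sup>2 \<le> \<xi> t * n\<^sup>2"
      using \<xi>_lower[OF late t] by (intro mult_right_mono) (auto simp: q_def)
    also have "\<dots> \<le> C" using energy_parts(2)[OF late t] C(1)[OF t] by (simp add: n_def power2_norm_eq_inner)
    finally have qn: "r0 * (\<alpha> * q * n\<^sup>2) \<le> C" by (simp add: mult.assoc)
    have "(\<rho> t * n)\<^sup>2 = 4 * r0 / \<alpha> * (r0 * (\<alpha> * q * n\<^sup>2)) * q"
      using \<alpha> by (simp add: \<rho>_def q_def[symmetric] power2_eq_square)
    also have "\<dots> \<le> 4 * r0 / \<alpha> * (r0 * (\<alpha> * q * n\<^sup>2)) * 1"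
      using q \<alpha> r0_pos by (intro mult_left_mono) auto
    also have "\<dots> \<le> 4 * r0 / \<alpha> * C * 1"
      using qn \<alpha> r0_pos by (intro mult_right_mono mult_left_mono) auto
    finally have sq: "(\<rho> t * n)\<^sup>2 \<le> 4 * r0 * C / \<alpha>" by simp
    \<comment> \<open>A square root is avoided by \<open>s \<le> s\<^sup>2 + 1/4\<close>.\<close>
    have "0 \<le> (\<rho> t * n - 1/2)\<^sup>2" by simp
    then have \<rho>n: "\<rho> t * n \<le> 1 + 4 * r0 * C / \<alpha>" using sq by (simp add: power2_diff power_divide)
    have "t powr r *\<^sub>R w t = v t - \<rho> t *\<^sub>R z t" by (simp add: v_def)
    then have "t powr r * norm (w t) = norm (v t - \<rho> t *\<^sub>R z t)" by (metis abs_of_nonneg norm_scaleR powr_ge_zero)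
    also have "\<dots> \<le> norm (v t) + \<rho> t * n"
      using norm_triangle_ineq4[of "v t" "\<rho> t *\<^sub>R z t"] r0_pos by (simp add: n_def \<rho>_def)
    also have "\<dots> \<le> C'" using C(2)[OF t] \<rho>n by (simp add: C'_def)
    finally show ?thesis using tt by (simp add: powr_minus field_simps)
  qed
  then show ?thesis by (intro bigoI[of _ C'] eventually_at_top_linorderI[of T])
qed

lemma integrable_of_dissipation:
  assumes cont: "continuous_on {t0..} h" and c: "c > 0"
    and h: "\<And>t. t \<ge> t0 \<Longrightarrow> 0 \<le> h t" "\<And>t. t \<ge> t0 \<Longrightarrow> c * h t \<le> dissipation t"
  shows "h absolutely_integrable_on {t0..}"
proof -
  obtain T where late: "late T" using late_exists by blast
  then have T: "t0 \<le> T" by (simp add: late_def)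
  obtain C where C: "\<And>t. t \<ge> T \<Longrightarrow> integral {T..t} dissipation \<le> C" using bounded_energy[OF late] by metis
  show ?thesis
  proof (rule nonneg_absolutely_integrable_on_halfline[OF cont _ T])
    fix S assume S: "S \<ge> T"
    have int: "f integrable_on {T..S}" if "continuous_on {t0..} f" for f :: "real \<Rightarrow> real"
      using T by (intro integrable_continuous_real continuous_on_subset[OF that]) auto
    have "c * integral {T..S} h = integral {T..S} (\<lambda>t. c * h t)" by simp
    also have "\<dots> \<le> integral {T..S} dissipation"
      using h T by (intro integral_le int dissipation_cont continuous_intros cont) auto
    also have "\<dots> \<le> C" by (rule C[OF S])
    finally show "integral {T..S} h \<le> C / c" using c by (simp add: field_simps)
  qed (use h T in auto)
qed

theorem weighted_integrability:
  shows "(\<lambda>t. t powr (2 * r - 1) * G (z t)) absolutely_integrable_on {t0..}"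
    and "(\<lambda>t. t powr (2 * r - 1) * Q (z t)) absolutely_integrable_on {t0..}"
    and "(\<lambda>t. t powr r * (norm (w t))\<^sup>2) absolutely_integrable_on {t0..}"
proof -
  have parts: "0 \<le> 2 * (r0 - r) * (t powr (2 * r - 1) * G (z t))"
    "0 \<le> 2 * r0 * (t powr (2 * r - 1) * Q (z t))" "0 \<le> \<alpha> / 2 * (t powr r * (norm (w t))\<^sup>2)" for t
    using r0 r0_pos \<alpha> G_nonneg Q_nonneg by simp_all
  show "(\<lambda>t. t powr (2 * r - 1) * G (z t)) absolutely_integrable_on {t0..}"
    using parts G_nonneg r0 unfolding dissipation_def
    by (intro integrable_of_dissipation[of _ "2 * (r0 - r)"] continuous_intros powr_cont G_z_cont)
      (auto simp: dissipation_def intro: add_increasing2)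
  show "(\<lambda>t. t powr (2 * r - 1) * Q (z t)) absolutely_integrable_on {t0..}"
    using parts Q_nonneg r0_pos
    by (intro integrable_of_dissipation[of _ "2 * r0"] continuous_intros powr_cont Q_z_cont)
      (auto simp: dissipation_def add_increasing add_increasing2)
  show "(\<lambda>t. t powr r * (norm (w t))\<^sup>2) absolutely_integrable_on {t0..}"
    using parts \<alpha>
    by (intro integrable_of_dissipation[of _ "\<alpha> / 2"] continuous_intros powr_cont w_cont)
      (auto simp: dissipation_def add_increasing add_increasing2)
qed

end

section \<open>The augmented Lagrangian around a saddle point\<close>

text \<open>The variable is the deviation \<open>(dx, dy, dl)\<close> from the saddle point throughout, so that the saddle
  point becomes the origin. The multiplier in the Lagrangian is fixed at \<open>ls\<close>, which is why the gap is
  independent of \<open>dl\<close> and its gradient has last component zero.\<close>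
definition aug_gradient ::
  "(real^'n1 \<Rightarrow> real) \<Rightarrow> (real^'n2 \<Rightarrow> real) \<Rightarrow> real^'n1^'m \<Rightarrow> real^'n2^'m
   \<Rightarrow> real^'n1 \<Rightarrow> real^'n2 \<Rightarrow> real^'m \<Rightarrow> (real^'n1) \<times> (real^'n2) \<times> (real^'m)
   \<Rightarrow> (real^'n1) \<times> (real^'n2) \<times> (real^'m)" where
  "aug_gradient f g A B xs ys ls = (\<lambda>(dx, dy, dl).
     (grad f (xs + dx) + transpose A *v (ls + (A *v dx + B *v dy)),
      grad g (ys + dy) + transpose B *v (ls + (A *v dx + B *v dy)), 0))"

text \<open>The part of the saddle-point operator with skew-symmetric matrix.\<close>
definition skew_coupling ::
  "real^'n1^'m \<Rightarrow> real^'n2^'m \<Rightarrow> (real^'n1) \<times> (real^'n2) \<times> (real^'m)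
   \<Rightarrow> (real^'n1) \<times> (real^'n2) \<times> (real^'m)" where
  "skew_coupling A B = (\<lambda>(dx, dy, dl). (- (transpose A *v dl), - (transpose B *v dl), A *v dx + B *v dy))"

definition aug_gap ::
  "(real^'n1 \<Rightarrow> real) \<Rightarrow> (real^'n2 \<Rightarrow> real) \<Rightarrow> real^'n1^'m \<Rightarrow> real^'n2^'m
   \<Rightarrow> real^'n1 \<Rightarrow> real^'n2 \<Rightarrow> real^'m \<Rightarrow> (real^'n1) \<times> (real^'n2) \<times> (real^'m) \<Rightarrow> real" where
  "aug_gap f g A B xs ys ls = (\<lambda>(dx, dy, dl).
     aug_Lagrangian f g A B (A *v xs + B *v ys) (xs + dx) (ys + dy) ls
     - aug_Lagrangian f g A B (A *v xs + B *v ys) xs ys ls)"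

definition residual_energy ::
  "real^'n1^'m \<Rightarrow> real^'n2^'m \<Rightarrow> (real^'n1) \<times> (real^'n2) \<times> (real^'m) \<Rightarrow> real" where
  "residual_energy A B = (\<lambda>(dx, dy, dl). 1/2 * (norm (A *v dx + B *v dy))\<^sup>2)"

lemma aug_gradient_inner:
  "aug_gradient f g A B xs ys ls (dx, dy, dl) \<bullet> (hx, hy, hl) =
    grad f (xs + dx) \<bullet> hx + grad g (ys + dy) \<bullet> hy + (ls + (A *v dx + B *v dy)) \<bullet> (A *v hx + B *v hy)"
  by (simp add: aug_gradient_def inner_add_left inner_add_right dot_lmul_matrix vector_matrix_left_distrib)

lemma skew_coupling_orthogonal: "skew_coupling A B p \<bullet> p = 0"
  by (cases p) (simp add: skew_coupling_def dot_lmul_matrix inner_add_left inner_commute[of "A *v _"] inner_commute[of "B *v _"])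

text \<open>Feasibility of the saddle point, built into the gap as \<open>b = A xs + B ys\<close>, makes the residual linear in
  the deviation.\<close>
lemma aug_gap_eq: "aug_gap f g A B xs ys ls (dx, dy, dl) =
    (f (xs + dx) - f xs) + (g (ys + dy) - g ys) + ls \<bullet> (A *v dx + B *v dy)
    + 1/2 * (norm (A *v dx + B *v dy))\<^sup>2"
proof -
  have "A *v (xs + dx) + B *v (ys + dy) - (A *v xs + B *v ys) = A *v dx + B *v dy"
    by (simp add: matrix_vector_right_distrib)
  then show ?thesis by (simp add: aug_gap_def aug_Lagrangian_def)
qed

lemma cont_differentiable_grad:
  fixes f :: "'a::euclidean_space \<Rightarrow> real"
  assumes "cont_differentiable f"
  shows "(f has_derivative (\<lambda>h. grad f x \<bullet> h)) (at x)" "continuous_on UNIV (grad f)"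
  using assms GDERIV_grad[of f x] by (auto simp: cont_differentiable_def gderiv_def inner_commute)

lemma aug_gap_derivative:
  assumes f: "cont_differentiable f" and g: "cont_differentiable g"
  shows "(aug_gap f g A B xs ys ls has_derivative (\<lambda>h. aug_gradient f g A B xs ys ls p \<bullet> h)) (at p)"
proof -
  obtain dx dy dl where p: "p = (dx, dy, dl)" by (cases p)
  define c where "c p = A *v fst p + B *v fst (snd p)" for p :: "(real^'a) \<times> (real^'b) \<times> (real^'c)"
  have lin: "bounded_linear c" unfolding c_def
    by (intro bounded_linear_add bounded_linear_compose[OF matrix_vector_mul_bounded_linear]
       bounded_linear_fst bounded_linear_snd bounded_linear_compose[OF bounded_linear_fst])
  have c: "(c has_derivative c) (at p)" using lin by (rule bounded_linear_imp_has_derivative)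
  have gap: "aug_gap f g A B xs ys ls = (\<lambda>p. (f (xs + fst p) - f xs) + (g (ys + fst (snd p)) - g ys)
      + ls \<bullet> c p + 1/2 * (c p \<bullet> c p))"
    by (simp add: fun_eq_iff aug_gap_eq c_def power2_norm_eq_inner split_paired_all)
  have F: "((\<lambda>p. f (xs + fst p)) has_derivative (\<lambda>h. grad f (xs + fst p) \<bullet> fst h)) (at p)"
    by (rule has_derivative_compose[OF _ cont_differentiable_grad(1)[OF f]]) (auto intro!: derivative_eq_intros)
  have G: "((\<lambda>p. g (ys + fst (snd p))) has_derivative (\<lambda>h. grad g (ys + fst (snd p)) \<bullet> fst (snd h))) (at p)"
    by (rule has_derivative_compose[OF _ cont_differentiable_grad(1)[OF g]]) (auto intro!: derivative_eq_intros)
  have "(aug_gap f g A B xs ys ls has_derivative (\<lambda>h. (grad f (xs + fst p) \<bullet> fst h - 0)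
      + (grad g (ys + fst (snd p)) \<bullet> fst (snd h) - 0) + ls \<bullet> c h + 1/2 * (c p \<bullet> c h + c h \<bullet> c p))) (at p)"
    unfolding gap
    by (intro has_derivative_add has_derivative_diff has_derivative_const F G has_derivative_mult_right
        has_derivative_inner_right has_derivative_inner c)
  moreover have "(\<lambda>h. (grad f (xs + fst p) \<bullet> fst h - 0)
      + (grad g (ys + fst (snd p)) \<bullet> fst (snd h) - 0) + ls \<bullet> c h + 1/2 * (c p \<bullet> c h + c h \<bullet> c p))
      = (\<lambda>h. aug_gradient f g A B xs ys ls p \<bullet> h)"
    by (simp add: fun_eq_iff p split_paired_all c_def[symmetric] aug_gradient_inner inner_commute[of "c _" "c p"])
      (simp add: c_def inner_add_left inner_add_right inner_commute[of "A *v dx"] inner_commute[of "B *v dy"])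
  ultimately show ?thesis by simp
qed

lemma matrix_vector_cont: "continuous_on S h \<Longrightarrow> continuous_on S (\<lambda>p. A *v h p)" for A :: "real^'n^'m"
  using bounded_linear.continuous_on[OF matrix_vector_mul_bounded_linear] .

lemma aug_gradient_cont:
  assumes f: "cont_differentiable f" and g: "cont_differentiable g"
  shows "continuous_on UNIV (aug_gradient f g A B xs ys ls)"
proof -
  have "continuous_on UNIV (\<lambda>p :: (real^'a) \<times> (real^'b) \<times> (real^'c). grad f (xs + fst p))"
    by (rule continuous_on_compose2[OF cont_differentiable_grad(2)[OF f]]) (auto intro!: continuous_intros)
  moreover have "continuous_on UNIV (\<lambda>p :: (real^'a) \<times> (real^'b) \<times> (real^'c). grad g (ys + fst (snd p)))"
    by (rule continuous_on_compose2[OF cont_differentiable_grad(2)[OF g]]) (auto intro!: continuous_intros)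
  ultimately show ?thesis unfolding aug_gradient_def case_prod_unfold
    by (intro continuous_intros matrix_vector_cont)
qed

lemma residual_energy_cont: "continuous_on UNIV (residual_energy A B)"
  unfolding residual_energy_def case_prod_unfold by (intro continuous_intros matrix_vector_cont)

lemma residual_energy_nonneg: "residual_energy A B p \<ge> 0"
  by (cases p) (simp add: residual_energy_def)

text \<open>By the optimality conditions the linear term \<open>ls \<bullet> (A dx + B dy)\<close> turns \<open>f\<close> and \<open>g\<close> into their distances
  above the tangent planes at the saddle point, which are nonnegative by convexity.\<close>
lemma aug_gap_ge_residual_energy:
  assumes f: "cont_differentiable f" "convex_on UNIV f" and g: "cont_differentiable g" "convex_on UNIV g"
    and opt: "- (transpose A *v ls) = grad f xs" "- (transpose B *v ls) = grad g ys"
  shows "aug_gap f g A B xs ys ls p \<ge> residual_energy A B p"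
proof -
  obtain dx dy dl where p: "p = (dx, dy, dl)" by (cases p)
  have "f (xs + dx) \<ge> f xs + grad f xs \<bullet> dx" "g (ys + dy) \<ge> g ys + grad g ys \<bullet> dy"
    using convex_on_above_gradient[OF f(2), of xs "xs + dx"] convex_on_above_gradient[OF g(2), of ys "ys + dy"]
      f(1) g(1) by (auto simp: cont_differentiable_def)
  moreover have "grad f xs \<bullet> dx = - (ls \<bullet> (A *v dx))" "grad g ys \<bullet> dy = - (ls \<bullet> (B *v dy))"
    by (simp_all flip: opt add: dot_lmul_matrix)
  ultimately show ?thesis by (simp add: p aug_gap_eq residual_energy_def inner_add_right)
qed

text \<open>Here the tangent planes are taken at the current point. The quadratic penalty is homogeneous of
  degree two, so its gradient paired with the deviation counts it twice; this is the origin of the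
  additional term.\<close>
lemma aug_gradient_inner_ge:
  assumes f: "cont_differentiable f" "convex_on UNIV f" and g: "cont_differentiable g" "convex_on UNIV g"
  shows "aug_gradient f g A B xs ys ls p \<bullet> p \<ge> aug_gap f g A B xs ys ls p + residual_energy A B p"
proof -
  obtain dx dy dl where p: "p = (dx, dy, dl)" by (cases p)
  define c where "c = A *v dx + B *v dy"
  have "f xs \<ge> f (xs + dx) - grad f (xs + dx) \<bullet> dx" "g ys \<ge> g (ys + dy) - grad g (ys + dy) \<bullet> dy"
    using convex_on_above_gradient[OF f(2), of "xs + dx" xs] convex_on_above_gradient[OF g(2), of "ys + dy" ys]
      f(1) g(1) by (auto simp: cont_differentiable_def)
  moreover have "aug_gradient f g A B xs ys ls p \<bullet> p
      = grad f (xs + dx) \<bullet> dx + grad g (ys + dy) \<bullet> dy + (ls \<bullet> c + c \<bullet> c)"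
    unfolding p aug_gradient_inner c_def by (simp only: inner_add_left)
  moreover have "aug_gap f g A B xs ys ls p + residual_energy A B p
      = (f (xs + dx) - f xs) + (g (ys + dy) - g ys) + (ls \<bullet> c + c \<bullet> c)"
    unfolding p aug_gap_eq residual_energy_def by (simp add: c_def[symmetric] power2_norm_eq_inner)
  ultimately show ?thesis by linarith
qed

lemma tderiv_has_vector_derivative:
  assumes "u differentiable (at t within {t0..})"
  shows "(u has_vector_derivative tderiv t0 u t) (at t within {t0..})"
  using assms unfolding tderiv_def by (rule vector_derivative_works[THEN iffD1])

lemma norm_triple_power2: "(norm (a, b, c))\<^sup>2 = (norm a)\<^sup>2 + (norm b)\<^sup>2 + (norm c)\<^sup>2"
  by (simp add: norm_Pair)

lemma norm_component_le: "norm a \<le> norm (a, b, c)" "norm b \<le> norm (a, b, c)" "norm c \<le> norm (a, b, c)"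
proof -
  show "norm a \<le> norm (a, b, c)" using norm_fst_le[of a "(b, c)"] .
  show "norm b \<le> norm (a, b, c)" using norm_fst_le[of b c] norm_snd_le[of "(b, c)" a] by simp
  show "norm c \<le> norm (a, b, c)" using norm_snd_le[of c b] norm_snd_le[of "(b, c)" a] by simp
qed

theorem theorem4p5:
  fixes f :: "real^'n1 \<Rightarrow> real" and g :: "real^'n2 \<Rightarrow> real"
    and A :: "real^'n1^'m" and B :: "real^'n2^'m" and b :: "real^'m"
    and t0 \<alpha> r r0 :: real
    and \<epsilon>1 :: "real \<Rightarrow> real^'n1" and \<epsilon>2 :: "real \<Rightarrow> real^'n2"
    and x :: "real \<Rightarrow> real^'n1" and y :: "real \<Rightarrow> real^'n2" and l :: "real \<Rightarrow> real^'m"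
    and xs :: "real^'n1" and ys :: "real^'n2" and ls :: "real^'m"
  assumes f: "cont_differentiable f" "convex_on UNIV f"
    and g: "cont_differentiable g" "convex_on UNIV g"
    and t0: "t0 \<ge> 1"
    and r: "0 \<le> r" "r < 1"
    and \<alpha>: "\<alpha> > 0"
    and r0: "r0 > r"
    and \<epsilon>_loc: "locally_integrable t0 \<epsilon>1" "locally_integrable t0 \<epsilon>2"
    and \<epsilon>1_int: "(\<lambda>t. t powr r * norm (\<epsilon>1 t)) absolutely_integrable_on {t0..}"
    and \<epsilon>2_int: "(\<lambda>t. t powr r * norm (\<epsilon>2 t)) absolutely_integrable_on {t0..}"
    and saddle: "(xs, ys, ls) \<in> Omega f g A B b"
    and sol: "global_solution f g A B b (\<lambda>t. \<alpha> / t powr r) (\<lambda>t. t / (2 * r0)) \<epsilon>1 \<epsilon>2 t0 x y l"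
  shows "((\<lambda>t. aug_Lagrangian f g A B b (x t) (y t) ls - aug_Lagrangian f g A B b xs ys ls)
           \<in> O[at_top](\<lambda>t. t powr (- 2 * r))) \<and>
     ((\<lambda>t. norm (A *v x t + B *v y t - b)) \<in> O[at_top](\<lambda>t. t powr (- r))) \<and>
     ((\<lambda>t. t powr (2 * r - 1) * (norm (A *v x t + B *v y t - b))\<^sup>2)
           absolutely_integrable_on {t0..}) \<and>
     ((\<lambda>t. t powr r * ((norm (tderiv t0 x t))\<^sup>2 + (norm (tderiv t0 y t))\<^sup>2
             + (norm (tderiv t0 l t))\<^sup>2)) absolutely_integrable_on {t0..}) \<and>
     ((\<lambda>t. t powr (2 * r - 1) *
             (aug_Lagrangian f g A B b (x t) (y t) ls - aug_Lagrangian f g A B b xs ys ls))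
           absolutely_integrable_on {t0..}) \<and>
     ((\<lambda>t. norm (tderiv t0 x t) + norm (tderiv t0 y t) + norm (tderiv t0 l t))
           \<in> O[at_top](\<lambda>t. t powr (- r)))"
proof -
  have opt: "- (transpose A *v ls) = grad f xs" "- (transpose B *v ls) = grad g ys"
    and feas: "b = A *v xs + B *v ys"
    using saddle by (auto simp: Omega_def)
  define z where "z t = (x t - xs, y t - ys, l t - ls)" for t
  define w where "w t = (tderiv t0 x t, tderiv t0 y t, tderiv t0 l t)" for t
  define \<epsilon> where "\<epsilon> t = (\<epsilon>1 t, \<epsilon>2 t, 0 :: real^'m)" for t
  define \<kappa> where "\<kappa> t = t powr r * norm (\<epsilon>1 t) + t powr r * norm (\<epsilon>2 t)" for t
  define G where "G = aug_gap f g A B xs ys ls"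
  define Q where "Q = residual_energy A B"
  have C1: "C1_halfline t0 x" "C1_halfline t0 y" "C1_halfline t0 l"
    and ac: "locally_absolutely_cont t0 (tderiv t0 x)" "locally_absolutely_cont t0 (tderiv t0 y)"
      "locally_absolutely_cont t0 (tderiv t0 l)"
    using sol by (auto simp: global_solution_def)
  obtain N where N: "negligible N" and eqs: "\<And>t. \<lbrakk>t \<ge> t0; t \<notin> N\<rbrakk> \<Longrightarrow>
        tderiv t0 x differentiable (at t within {t0..}) \<and>
        tderiv t0 y differentiable (at t within {t0..}) \<and>
        tderiv t0 l differentiable (at t within {t0..}) \<and>
        tderiv t0 (tderiv t0 x) t + (\<alpha> / t powr r) *\<^sub>R tderiv t0 x t =
          - grad f (x t) - transpose A *v (l t + (t / (2 * r0)) *\<^sub>R tderiv t0 l t)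
          - transpose A *v (A *v x t + B *v y t - b) + \<epsilon>1 t \<and>
        tderiv t0 (tderiv t0 y) t + (\<alpha> / t powr r) *\<^sub>R tderiv t0 y t =
          - grad g (y t) - transpose B *v (l t + (t / (2 * r0)) *\<^sub>R tderiv t0 l t)
          - transpose B *v (A *v x t + B *v y t - b) + \<epsilon>2 t \<and>
        tderiv t0 (tderiv t0 l) t + (\<alpha> / t powr r) *\<^sub>R tderiv t0 l t =
          A *v (x t + (t / (2 * r0)) *\<^sub>R tderiv t0 x t) + B *v (y t + (t / (2 * r0)) *\<^sub>R tderiv t0 y t) - b"
  proof -
    from sol obtain N where "N \<in> null_sets lebesgue"
      "{t \<in> space lebesgue. \<not> (t \<in> {t0..} \<longrightarrow>
        tderiv t0 x differentiable (at t within {t0..}) \<and>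
        tderiv t0 y differentiable (at t within {t0..}) \<and>
        tderiv t0 l differentiable (at t within {t0..}) \<and>
        tderiv t0 (tderiv t0 x) t + (\<alpha> / t powr r) *\<^sub>R tderiv t0 x t =
          - grad f (x t) - transpose A *v (l t + (t / (2 * r0)) *\<^sub>R tderiv t0 l t)
          - transpose A *v (A *v x t + B *v y t - b) + \<epsilon>1 t \<and>
        tderiv t0 (tderiv t0 y) t + (\<alpha> / t powr r) *\<^sub>R tderiv t0 y t =
          - grad g (y t) - transpose B *v (l t + (t / (2 * r0)) *\<^sub>R tderiv t0 l t)
          - transpose B *v (A *v x t + B *v y t - b) + \<epsilon>2 t \<and>
        tderiv t0 (tderiv t0 l) t + (\<alpha> / t powr r) *\<^sub>R tderiv t0 l t =
          A *v (x t + (t / (2 * r0)) *\<^sub>R tderiv t0 x t) + B *v (y t + (t / (2 * r0)) *\<^sub>R tderiv t0 y t) - b)} \<subseteq> N"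
      unfolding global_solution_def eventually_ae_filter by blast
    then show thesis by (intro that[of N]) (auto simp: negligible_iff_null_sets)
  qed
  interpret skew_inertial_flow z w \<epsilon> "aug_gradient f g A B xs ys ls" "skew_coupling A B" G Q \<kappa> N t0 \<alpha> r r0
  proof
    show "(z has_vector_derivative w t) (at t within {t0..})" if "t \<ge> t0" for t
      unfolding z_def[abs_def] w_def using C1 that
      by (auto intro!: has_vector_derivative_Pair
          simp: has_vector_derivative_diff_const C1_halfline_def tderiv_has_vector_derivative)
    show "continuous_on {t0..} w"
      unfolding w_def[abs_def] using C1 by (auto intro!: continuous_intros simp: C1_halfline_def)
    show "absolutely_cont_on a b w" if "t0 \<le> a" "a \<le> b" for a b
      unfolding w_def[abs_def] using ac that by (intro absolutely_cont_on_Pair) (auto simp: locally_absolutely_cont_def)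
    show "(w has_vector_derivative skew_coupling A B (z t + (t / (2 * r0)) *\<^sub>R w t)
        - aug_gradient f g A B xs ys ls (z t) - (\<alpha> / t powr r) *\<^sub>R w t + \<epsilon> t) (at t within {t0..})"
      if t: "t \<ge> t0" "t \<notin> N" for t
    proof -
      note e = eqs[OF t]
      have "(w has_vector_derivative (tderiv t0 (tderiv t0 x) t, tderiv t0 (tderiv t0 y) t, tderiv t0 (tderiv t0 l) t))
          (at t within {t0..})"
        unfolding w_def[abs_def] using e by (intro has_vector_derivative_Pair tderiv_has_vector_derivative) auto
      moreover have "(tderiv t0 (tderiv t0 x) t, tderiv t0 (tderiv t0 y) t, tderiv t0 (tderiv t0 l) t)
          = skew_coupling A B (z t + (t / (2 * r0)) *\<^sub>R w t)
          - aug_gradient f g A B xs ys ls (z t) - (\<alpha> / t powr r) *\<^sub>R w t + \<epsilon> t"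
      proof -
        define \<gamma> d where "\<gamma> = \<alpha> / t powr r" and "d = t / (2 * r0)"
        have "tderiv t0 (tderiv t0 x) t = - grad f (x t) - transpose A *v (l t + d *\<^sub>R tderiv t0 l t)
            - transpose A *v (A *v x t + B *v y t - b) + \<epsilon>1 t - \<gamma> *\<^sub>R tderiv t0 x t"
          "tderiv t0 (tderiv t0 y) t = - grad g (y t) - transpose B *v (l t + d *\<^sub>R tderiv t0 l t)
            - transpose B *v (A *v x t + B *v y t - b) + \<epsilon>2 t - \<gamma> *\<^sub>R tderiv t0 y t"
          "tderiv t0 (tderiv t0 l) t = A *v (x t + d *\<^sub>R tderiv t0 x t) + B *v (y t + d *\<^sub>R tderiv t0 y t) - b
            - \<gamma> *\<^sub>R tderiv t0 l t"
          using e unfolding \<gamma>_def[symmetric] d_def[symmetric] by (simp_all add: eq_diff_eq)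
        then show ?thesis
          unfolding \<gamma>_def[symmetric] d_def[symmetric]
          by (simp add: z_def w_def \<epsilon>_def skew_coupling_def aug_gradient_def feas
              matrix_vector_right_distrib matrix_vector_mult_diff_distrib algebra_simps
              flip: scaleR_vector_matrix_assoc)
      qed
      ultimately show ?thesis by simp
    qed
    show "(G has_derivative (\<lambda>h. aug_gradient f g A B xs ys ls p \<bullet> h)) (at p)" for p
      unfolding G_def by (rule aug_gap_derivative[OF f(1) g(1)])
    show "0 \<le> Q p" for p unfolding Q_def by (rule residual_energy_nonneg)
    show "0 \<le> G p" for p
      unfolding G_def using aug_gap_ge_residual_energy[OF f g opt] residual_energy_nonneg order_trans by blast
    show "G p + Q p \<le> aug_gradient f g A B xs ys ls p \<bullet> p" for p
      unfolding G_def Q_def by (rule aug_gradient_inner_ge[OF f g])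
    show "\<kappa> integrable_on {t0..}" unfolding \<kappa>_def[abs_def]
      using \<epsilon>1_int \<epsilon>2_int by (intro integrable_add set_lebesgue_integral_eq_integral(1))
    show "t powr r * norm (\<epsilon> t) \<le> \<kappa> t" for t
    proof -
      have "norm (\<epsilon> t) \<le> norm (\<epsilon>1 t) + norm (\<epsilon>2 t)"
        unfolding \<epsilon>_def using norm_Pair_le[of "\<epsilon>1 t" "(\<epsilon>2 t, 0 :: real^'m)"] norm_Pair_le[of "\<epsilon>2 t" "0 :: real^'m"] by simp
      then have "t powr r * norm (\<epsilon> t) \<le> t powr r * (norm (\<epsilon>1 t) + norm (\<epsilon>2 t))" by (intro mult_left_mono) auto
      then show ?thesis by (simp add: \<kappa>_def distrib_left)
    qed
  qed (fact t0 r \<alpha> r0 N skew_coupling_orthogonal aug_gradient_cont[OF f(1) g(1)]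
      residual_energy_cont[of A B, folded Q_def])+
  have gap: "aug_Lagrangian f g A B b (x t) (y t) ls - aug_Lagrangian f g A B b xs ys ls = G (z t)" for t
    by (simp add: G_def aug_gap_def z_def feas)
  have res: "(norm (A *v x t + B *v y t - b))\<^sup>2 = 2 * Q (z t)" for t
    by (simp add: Q_def residual_energy_def z_def feas matrix_vector_mult_diff_distrib algebra_simps)
  have speed: "(norm (tderiv t0 x t))\<^sup>2 + (norm (tderiv t0 y t))\<^sup>2 + (norm (tderiv t0 l t))\<^sup>2 = (norm (w t))\<^sup>2" for t
    by (simp add: w_def norm_triple_power2)
  have "(\<lambda>t. norm (A *v x t + B *v y t - b)) \<in> O[at_top](\<lambda>t. t powr (- r))"
  proof -
    obtain c where c: "c > 0" "\<forall>\<^sub>F t in at_top. norm (G (z t)) \<le> c * norm (t powr (- 2 * r))"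
      using potential_decay by (elim landau_o.bigE)
    have "\<forall>\<^sub>F t in at_top. norm (norm (A *v x t + B *v y t - b)) \<le> sqrt (2 * c) * norm (t powr (- r))"
      using c(2)
    proof eventually_elim
      case (elim t)
      have "Q (z t) \<le> G (z t)"
        unfolding G_def Q_def by (rule aug_gap_ge_residual_energy[OF f g opt])
      then have "(norm (A *v x t + B *v y t - b))\<^sup>2 \<le> 2 * c * t powr (- 2 * r)"
        using elim res[of t] by simp
      also have "\<dots> = (sqrt (2 * c) * t powr (- r))\<^sup>2"
      proof -
        have twice: "- 2 * r = - r + - r" by simp
        have "(t powr (- r))\<^sup>2 = t powr (- 2 * r)" by (simp only: twice power2_eq_square powr_add)
        moreover have "(sqrt (2 * c))\<^sup>2 = 2 * c" using c(1) by simp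
        ultimately show ?thesis by (simp only: power_mult_distrib)
      qed
      finally have "norm (A *v x t + B *v y t - b) \<le> sqrt (2 * c) * t powr (- r)"
        by (rule power2_le_imp_le) (use c(1) in simp)
      then show ?case by simp
    qed
    then show ?thesis by (rule bigoI)
  qed
  moreover have "(\<lambda>t. norm (tderiv t0 x t) + norm (tderiv t0 y t) + norm (tderiv t0 l t)) \<in> O[at_top](\<lambda>t. t powr (- r))"
  proof (rule landau_o.big_trans[OF _ velocity_decay])
    have "norm (norm (tderiv t0 x t) + norm (tderiv t0 y t) + norm (tderiv t0 l t)) \<le> 3 * norm (norm (w t))" for t
      unfolding w_def
      using norm_component_le(1)[of "tderiv t0 x t" "tderiv t0 y t" "tderiv t0 l t"]
        norm_component_le(2)[of "tderiv t0 y t" "tderiv t0 x t" "tderiv t0 l t"]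
        norm_component_le(3)[of "tderiv t0 l t" "tderiv t0 x t" "tderiv t0 y t"] by simp
    then show "(\<lambda>t. norm (tderiv t0 x t) + norm (tderiv t0 y t) + norm (tderiv t0 l t)) \<in> O[at_top](\<lambda>t. norm (w t))"
      by (intro bigoI[of _ 3]) auto
  qed
  moreover have "(\<lambda>t. t powr (2 * r - 1) * (2 * Q (z t))) absolutely_integrable_on {t0..}"
    using set_integrable_mult_right[of 2, OF weighted_integrability(2)] by (simp add: mult.left_commute)
  ultimately show ?thesis
    unfolding gap res speed using potential_decay weighted_integrability by blast
qed

end
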